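(* For $\tau$ in the upper half-plane and complex $x,y$ at which both sides are defined, \begin{align*} &\frac{1}{\cos 2x}+\frac{1}{\cos 2y}+4\sum_{n=1}^\infty \left(\frac{-4}{n}\right)\frac{q^n}{1-q^n}\left(\cos 2nx +\cos 2ny\right) =\vartheta_2^2(\tau)\frac{\theta_2(x+y|\tau)\theta_2(x-y|\tau)}{2\theta_2(2x|2\tau)\theta_2(2y|2\tau)}. \end{align*}
   Context: $q=e^{2\pi i\tau}$, $q^a=e^{2\pi i a\tau}$; $\left(\frac{-4}{n}\right)$ is the Kronecker symbol; $\theta_2(z|\tau)=2\sum_{n\ge0}q^{(2n+1)^2/8}\cos(2n+1)z$ and $\vartheta_2(\tau)=\theta_2(0|\tau)$. *)

theory Defs
  imports "HOL-Analysis.Analysis" "HOL-Number_Theory.Residues"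
begin

text \<open>With \<open>q = exp (2 \<pi> i \<tau>)\<close>, real powers of \<open>q\<close> are
  fixed by \<open>q\<^sup>a = exp (2 \<pi> i a \<tau>)\<close>, which is in general not the principal
  branch of \<open>q powr a\<close>.\<close>

definition qpow :: "complex \<Rightarrow> real \<Rightarrow> complex"
  where "qpow \<tau> a = exp (2 * of_real pi * \<i> * of_real a * \<tau>)"

definition theta2 :: "complex \<Rightarrow> complex \<Rightarrow> complex"
  where "theta2 z \<tau> =
    2 * (\<Sum>n. qpow \<tau> ((2 * real n + 1)\<^sup>2 / 8) * cos ((2 * of_nat n + 1) * z))"

definition vartheta2 :: "complex \<Rightarrow> complex"
  where "vartheta2 \<tau> = theta2 0 \<tau>"

definition kronecker_prime :: "int \<Rightarrow> int \<Rightarrow> int"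
  where "kronecker_prime a p =
    (if p = 2 then (if even a then 0 else if a mod 8 \<in> {1, 7} then 1 else - 1)
     else Legendre a p)"

text \<open>The Kronecker symbol \<open>(a/n)\<close> for all integers: the factor in front of the product
  is the value at the unit \<open>sgn n\<close>.\<close>

definition kronecker :: "int \<Rightarrow> int \<Rightarrow> int"
  where "kronecker a n =
    (if n = 0 then (if \<bar>a\<bar> = 1 then 1 else 0)
     else (if n < 0 \<and> a < 0 then - 1 else 1) *
       (\<Prod>p\<in>prime_factors n. kronecker_prime a p ^ multiplicity p n))"

end

theory Submission
  imports Defs "HOL-Number_Theory.Euler_Criterion"
begin

text \<open>
  Write \<open>q = exp (2 \<pi> \<i> \<tau>)\<close>, \<open>v = exp (4 \<i> x)\<close> and
  \<open>J q v = \<Sum>\<^sub>n q^(n\<^sup>2) v^n\<close>. In the annulus \<open>1 < |v| < |q|^(-2)\<close> the \<open>x\<close>-part of the left-hand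
  side is, up to a monomial, the bilateral series \<open>\<Sum>\<^sub>k (-1)^k v^(-k) / (1 - q^(2k+1))\<close>. Multiplying by
  \<open>J q (q v)\<close>, the coefficients \<open>C\<^sub>m\<close> of the product satisfy \<open>C\<^sub>m = q^(2m-1) C\<^sub>m\<^sub>-\<^sub>1\<close>, so the product
  is \<open>C\<^sub>0 J q v\<close>. This extends to \<open>|v| \<le> 1\<close> by the symmetry \<open>v \<mapsto> 1 / v\<close> and by continuity.
  Comparing the identity at \<open>v = 1\<close> and \<open>v = 1 / q\<close> shows that \<open>C\<^sub>0 / (J q q * J q 1)\<close> does not change
  under \<open>q \<mapsto> q\<^sup>2\<close>, and \<open>q \<rightarrow> 0\<close> gives the value \<open>1/2\<close>. Adding the identities for \<open>x\<close> and \<open>y\<close>, the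
  numerator factors by the addition formula for \<open>\<theta>\<^sub>2(x + y) \<theta>\<^sub>2(x - y)\<close>, obtained by splitting a double
  sum over \<open>(m, n)\<close> according to the parity of \<open>m + n\<close>.
\<close>

section \<open>Sums over the integers\<close>

text \<open>Summability of a complex family is the same as absolute summability, so the norms of the
  product family can be summed row by row, which makes it summable on the product set.\<close>

lemma has_sum_mult_complex:
  fixes f :: "'a \<Rightarrow> complex" and g :: "'b \<Rightarrow> complex"
  assumes f: "(f has_sum a) A" and g: "(g has_sum b) B"
  shows "((\<lambda>(x, y). f x * g y) has_sum (a * b)) (A \<times> B)"
proof (rule has_sum_SigmaI)
  show "((\<lambda>y. case (x, y) of (x, y) \<Rightarrow> f x * g y) has_sum (f x * b)) B" for x
    using has_sum_cmult_right[OF g, of "f x"] by simp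
  show "((\<lambda>x. f x * b) has_sum (a * b)) A"
    by (rule has_sum_cmult_left[OF f])
  have fa: "(\<lambda>x. norm (f x)) summable_on A" and ga: "(\<lambda>x. norm (g x)) summable_on B"
    using f g has_sum_imp_summable summable_on_iff_abs_summable_on_complex by blast+
  have "(\<lambda>z. norm (case z of (x, y) \<Rightarrow> f x * g y)) summable_on (A \<times> B)"
  proof (subst Infinite_Sum.abs_summable_on_Sigma_iff, intro conjI ballI)
    show "(\<lambda>y. norm (case (x, y) of (x, y) \<Rightarrow> f x * g y)) summable_on B" for x
      using summable_on_cmult_right[OF ga, of "norm (f x)"] by (simp add: norm_mult)
    have "(\<lambda>x. norm (f x) * (\<Sum>\<^sub>\<infinity>y\<in>B. norm (g y))) summable_on A"
      by (rule summable_on_cmult_left[OF fa])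
    also have "(\<lambda>x. norm (f x) * (\<Sum>\<^sub>\<infinity>y\<in>B. norm (g y))) =
        (\<lambda>x. norm (\<Sum>\<^sub>\<infinity>y\<in>B. norm (case (x, y) of (x, y) \<Rightarrow> f x * g y)))"
      by (simp add: norm_mult infsum_cmult_right' infsum_nonneg abs_mult)
    finally show "(\<lambda>x. norm (\<Sum>\<^sub>\<infinity>y\<in>B. norm (case (x, y) of (x, y) \<Rightarrow> f x * g y))) summable_on A" .
  qed
  thus "(\<lambda>(x, y). f x * g y) summable_on (A \<times> B)"
    using summable_on_iff_abs_summable_on_complex by blast
qed

lemma has_sum_int_split:
  fixes f :: "int \<Rightarrow> 'a :: topological_comm_monoid_add"
  assumes "((\<lambda>n. f (int n)) has_sum a) UNIV" "((\<lambda>n. f (- int n - 1)) has_sum b) UNIV"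
  shows "(f has_sum (a + b)) UNIV"
proof -
  have "(f has_sum a) {0..}"
    using assms(1)
    by (subst (asm) has_sum_reindex_bij_witness[of _ nat int "{0..}" f _ a a]) auto
  moreover have "(f has_sum b) {..<0}"
    using assms(2)
    by (subst (asm) has_sum_reindex_bij_witness[of _ "\<lambda>k. nat (- k - 1)" "\<lambda>n. - int n - 1" "{..<0}" f _ b b]) auto
  ultimately have "(f has_sum (a + b)) ({0..} \<union> {..<0})"
    by (intro has_sum_Un_disjoint) auto
  moreover have "{0..} \<union> {..<0} = (UNIV :: int set)"
    by auto
  ultimately show ?thesis
    by simp
qed

lemma has_sum_int_sums:
  fixes f :: "int \<Rightarrow> complex"
  assumes "summable (\<lambda>n. norm (f (int n)))" "summable (\<lambda>n. norm (f (- int n - 1)))"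
  shows "(f has_sum ((\<Sum>n. f (int n)) + (\<Sum>n. f (- int n - 1)))) UNIV"
  by (rule has_sum_int_split[OF
        norm_summable_imp_has_sum[OF assms(1) summable_sums[OF summable_norm_cancel[OF assms(1)]]]
        norm_summable_imp_has_sum[OF assms(2) summable_sums[OF summable_norm_cancel[OF assms(2)]]]])

text \<open>Each pair with even coordinate sum is \<open>(s + t, s - t)\<close> for exactly one
  \<open>(s, t)\<close>, and each remaining pair is \<open>(s + t + 1, s - t)\<close> for exactly
  one \<open>(s, t)\<close>. This is the rearrangement behind the product formula for theta
  functions.\<close>

lemma has_sum_even_odd_int:
  fixes f :: "int \<times> int \<Rightarrow> complex"
  assumes "((\<lambda>(s, t). f (s + t, s - t)) has_sum a) UNIV"
    and "((\<lambda>(s, t). f (s + t + 1, s - t)) has_sum b) UNIV"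
  shows "(f has_sum (a + b)) UNIV"
proof -
  let ?E = "{(m, n). even (m + n)} :: (int \<times> int) set"
  let ?i = "\<lambda>(m, n). ((m + n) div 2, (m - n) div 2) :: int \<times> int"
  have "((\<lambda>(s, t). f (s + t, s - t)) has_sum a) UNIV \<longleftrightarrow> (f has_sum a) ?E"
  proof (rule has_sum_reindex_bij_witness[of _ ?i "\<lambda>(s, t). (s + t, s - t)"])
    show "(case ?i z of (s, t) \<Rightarrow> (s + t, s - t)) = z" if "z \<in> ?E" for z
      using that by (cases z, simp) presburger
  qed auto
  with assms(1) have "(f has_sum a) ?E"
    by blast
  moreover have "((\<lambda>(s, t). f (s + t + 1, s - t)) has_sum b) UNIV \<longleftrightarrow> (f has_sum b) (- ?E)"
  proof (rule has_sum_reindex_bij_witness[of _ ?i "\<lambda>(s, t). (s + t + 1, s - t)"])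
    show "(case ?i z of (s, t) \<Rightarrow> (s + t + 1, s - t)) = z" if "z \<in> - ?E" for z
      using that by (cases z, simp) presburger
  qed auto
  with assms(2) have "(f has_sum b) (- ?E)"
    by blast
  ultimately have "(f has_sum (a + b)) (?E \<union> - ?E)"
    by (intro has_sum_Un_disjoint) auto
  thus ?thesis
    by simp
qed

section \<open>The theta function\<close>

text \<open>Jacobi's \<open>theta_3\<close> in multiplicative variables: \<open>q\<close> is the
  nome and \<open>v = exp (2 * i * z)\<close>. Integer powers of \<open>q\<close> and
  \<open>v\<close> avoid any choice of branch.\<close>

definition jtheta :: "complex \<Rightarrow> complex \<Rightarrow> complex"
  where "jtheta q v = (\<Sum>\<^sub>\<infinity>n. q powi (n\<^sup>2) * v powi n)"

text \<open>The term is the \<open>n\<close>-th power of \<open>q ^ n * v\<close>, whose norm is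
  eventually below \<open>1 / 2\<close>, whatever \<open>v\<close> is.\<close>

lemma summable_norm_square_power:
  fixes q v :: complex
  assumes "norm q < 1"
  shows "summable (\<lambda>n. norm (q ^ (n\<^sup>2) * v ^ n))"
proof (rule summable_comparison_test_ev)
  have "(\<lambda>n. norm (q ^ n * v)) \<longlonglongrightarrow> norm (0 * v)"
    by (intro tendsto_intros LIMSEQ_power_zero assms)
  hence "eventually (\<lambda>n. norm (q ^ n * v) < 1 / 2) sequentially"
    by (rule order_tendstoD) simp
  thus "eventually (\<lambda>n. norm (norm (q ^ (n\<^sup>2) * v ^ n)) \<le> (1 / 2) ^ n) sequentially"
  proof eventually_elim
    case (elim n)
    have "norm (norm (q ^ (n\<^sup>2) * v ^ n)) = norm (q ^ n * v) ^ n"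
      by (simp add: power2_eq_square norm_mult norm_power power_mult power_mult_distrib)
    also have "\<dots> \<le> (1 / 2) ^ n"
      using elim by (intro power_mono) auto
    finally show ?case .
  qed
qed simp

lemma powi_uminus_Suc: "v powi (- int n - 1) = inverse v ^ Suc n" for v :: complex
proof -
  have "- int n - 1 = - int (Suc n)" by simp
  thus ?thesis
    by (metis power_int_minus power_int_of_nat power_inverse)
qed

lemma powi_square: "q powi ((int n)\<^sup>2) = q ^ (n\<^sup>2)" "q powi ((- int n - 1)\<^sup>2) = q ^ ((Suc n)\<^sup>2)"
  for q :: complex
proof -
  show "q powi ((int n)\<^sup>2) = q ^ (n\<^sup>2)"
    by (metis of_nat_power power_int_of_nat)
  have "(- int n - 1)\<^sup>2 = int ((Suc n)\<^sup>2)"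
    by (simp add: power2_eq_square algebra_simps)
  thus "q powi ((- int n - 1)\<^sup>2) = q ^ ((Suc n)\<^sup>2)"
    by (metis power_int_of_nat)
qed

lemma powi_double: "q \<noteq> 0 \<Longrightarrow> q powi (2 * k) = q powi k * q powi k" for q :: complex
  by (metis mult_2 power_int_add)

lemma has_sum_jtheta_aux:
  fixes q v :: complex
  assumes "norm q < 1"
  shows "((\<lambda>n. q powi (n\<^sup>2) * v powi n) has_sum
     ((\<Sum>n. q ^ (n\<^sup>2) * v ^ n) + (\<Sum>n. q ^ ((Suc n)\<^sup>2) * inverse v ^ Suc n))) UNIV"
proof -
  have s: "summable (\<lambda>n. norm (q ^ ((Suc n)\<^sup>2) * inverse v ^ Suc n))"
    using summable_norm_square_power[OF assms, of "inverse v"]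
    by (subst summable_Suc_iff[where f = "\<lambda>n. norm (q ^ (n\<^sup>2) * inverse v ^ n)"])
  show ?thesis
    using has_sum_int_sums[of "\<lambda>n. q powi (n\<^sup>2) * v powi n", unfolded powi_square powi_uminus_Suc]
      s summable_norm_square_power[OF assms, of v] by (simp del: power_Suc)
qed

lemma has_sum_jtheta:
  assumes "norm q < 1"
  shows "((\<lambda>n. q powi (n\<^sup>2) * v powi n) has_sum jtheta q v) UNIV"
  unfolding jtheta_def
  by (rule has_sum_infsum[OF has_sum_imp_summable[OF has_sum_jtheta_aux[OF assms]]])

lemma jtheta_eqI:
  assumes "norm q < 1" "((\<lambda>n. q powi (n\<^sup>2) * v powi n) has_sum S) UNIV"
  shows "S = jtheta q v"
  by (rule has_sum_unique[OF assms(2) has_sum_jtheta[OF assms(1)]])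

text \<open>Both power series contain the term with index 0, hence the subtracted 1. In this form
  the symmetry under inversion of \<open>v\<close> is visible, and continuity reduces to that of
  power series.\<close>

lemma jtheta_conv_suminf:
  assumes "norm q < 1"
  shows "jtheta q v = (\<Sum>n. q ^ (n\<^sup>2) * v ^ n) + (\<Sum>n. q ^ (n\<^sup>2) * inverse v ^ n) - 1"
proof -
  have "(\<Sum>n. q ^ (n\<^sup>2) * inverse v ^ n) = 1 + (\<Sum>n. q ^ ((Suc n)\<^sup>2) * inverse v ^ Suc n)"
    using suminf_split_head[of "\<lambda>n. q ^ (n\<^sup>2) * inverse v ^ n"]
      summable_norm_cancel[OF summable_norm_square_power[OF assms, of "inverse v"]] by simp
  thus ?thesis
    using jtheta_eqI[OF assms has_sum_jtheta_aux[OF assms]] by simp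
qed

lemma jtheta_inverse: "norm q < 1 \<Longrightarrow> jtheta q (inverse v) = jtheta q v"
  by (simp add: jtheta_conv_suminf)

text \<open>Quasi-periodicity: shift the index by one and use
  \<open>(n + 1)^2 = 1 + n^2 + 2 * n\<close>.\<close>

lemma jtheta_q2_mult:
  assumes "norm q < 1" "q \<noteq> 0" "v \<noteq> 0"
  shows "q * v * jtheta q (q\<^sup>2 * v) = jtheta q v"
proof (rule jtheta_eqI[OF assms(1)])
  have "((\<lambda>n. q * v * (q powi (n\<^sup>2) * (q\<^sup>2 * v) powi n)) has_sum (q * v * jtheta q (q\<^sup>2 * v))) UNIV"
    by (intro has_sum_cmult_right has_sum_jtheta assms)
  also have "?this \<longleftrightarrow> ((\<lambda>n. q powi (n\<^sup>2) * v powi n) has_sum (q * v * jtheta q (q\<^sup>2 * v))) UNIV"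
  proof (rule has_sum_reindex_bij_witness[of _ "\<lambda>n. n - 1" "\<lambda>n. n + 1"])
    fix n :: int
    have e: "(n + 1)\<^sup>2 = 1 + (n\<^sup>2 + (n + n))"
      by (simp add: power2_eq_square algebra_simps)
    show "q powi ((n + 1)\<^sup>2) * v powi (n + 1) = q * v * (q powi (n\<^sup>2) * (q\<^sup>2 * v) powi n)"
      unfolding e using assms
      by (simp add: power_int_add power_int_mult_distrib power2_eq_square powi_double)
  qed auto
  finally show "((\<lambda>n. q powi (n\<^sup>2) * v powi n) has_sum (q * v * jtheta q (q\<^sup>2 * v))) UNIV" .
qed

text \<open>Quasi-periodicity at \<open>v / q\<close> combined with the inversion symmetry. At
  \<open>v = -1\<close> it exhibits the zero \<open>- q\<close> of the theta function.\<close>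

lemma jtheta_q_inverse:
  assumes "norm q < 1" "q \<noteq> 0" "v \<noteq> 0"
  shows "jtheta q (q * inverse v) = v * jtheta q (q * v)"
proof -
  have v: "q * (v / q) = v" "q\<^sup>2 * (v / q) = q * v" "inverse (q * inverse v) = v / q"
    using assms(2,3) by (simp_all add: power2_eq_square divide_simps)
  show ?thesis
    using jtheta_q2_mult[OF assms(1,2), of "v / q"] jtheta_inverse[OF assms(1), of "q * inverse v"] assms
    unfolding v by auto
qed

text \<open>Expand the product as a double sum over \<open>(m, n)\<close> and split by the parity of
  \<open>m + n\<close>. With \<open>m = s + t\<close>, \<open>n = s - t\<close> the exponent becomes
  \<open>2 * s^2 + 2 * t^2\<close>, so the even class factors with nome \<open>p^2\<close>. In the
  odd class \<open>m\<close> is larger by one, which produces \<open>p * a\<close> and the arguments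
  scaled by \<open>p^2\<close>.\<close>

lemma jtheta_mult:
  assumes "norm p < 1" "p \<noteq> 0" "a \<noteq> 0" "b \<noteq> 0"
  shows "jtheta p a * jtheta p b = jtheta (p\<^sup>2) (a * b) * jtheta (p\<^sup>2) (a / b)
    + p * a * (jtheta (p\<^sup>2) (p\<^sup>2 * (a * b)) * jtheta (p\<^sup>2) (p\<^sup>2 * (a / b)))"
proof -
  let ?f = "\<lambda>(m, n). (p powi (m\<^sup>2) * a powi m) * (p powi (n\<^sup>2) * b powi n)"
  have p2: "norm (p\<^sup>2) < 1"
    using assms by (simp add: norm_power power_less_one_iff)
  have "(?f has_sum (jtheta p a * jtheta p b)) (UNIV \<times> UNIV)"
    by (intro has_sum_mult_complex has_sum_jtheta assms)
  hence 1: "(?f has_sum (jtheta p a * jtheta p b)) UNIV"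
    by simp
  have 2: "((\<lambda>(s, t). ((p\<^sup>2) powi (s\<^sup>2) * (a * b) powi s) * ((p\<^sup>2) powi (t\<^sup>2) * (a / b) powi t)) has_sum
      (jtheta (p\<^sup>2) (a * b) * jtheta (p\<^sup>2) (a / b))) (UNIV \<times> UNIV)"
    by (intro has_sum_mult_complex has_sum_jtheta p2)
  have 3: "((\<lambda>x. p * a * (case x of (s, t) \<Rightarrow>
        ((p\<^sup>2) powi (s\<^sup>2) * (p\<^sup>2 * (a * b)) powi s) * ((p\<^sup>2) powi (t\<^sup>2) * (p\<^sup>2 * (a / b)) powi t))) has_sum
      (p * a * (jtheta (p\<^sup>2) (p\<^sup>2 * (a * b)) * jtheta (p\<^sup>2) (p\<^sup>2 * (a / b))))) (UNIV \<times> UNIV)"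
    by (intro has_sum_cmult_right has_sum_mult_complex has_sum_jtheta p2)
  have pp: "(p\<^sup>2) powi k = p powi k * p powi k" for k
    by (simp add: power2_eq_square power_int_mult_distrib)
  have e1: "(s + t)\<^sup>2 + (s - t)\<^sup>2 = s\<^sup>2 + s\<^sup>2 + (t\<^sup>2 + t\<^sup>2)"
    "(s + t + 1)\<^sup>2 + (s - t)\<^sup>2 = 1 + (s\<^sup>2 + s\<^sup>2 + (t\<^sup>2 + t\<^sup>2) + (s + s) + (t + t))" for s t :: int
    by (simp_all add: power2_eq_square algebra_simps)
  have g1: "?f (s + t, s - t) =
      ((p\<^sup>2) powi (s\<^sup>2) * (a * b) powi s) * ((p\<^sup>2) powi (t\<^sup>2) * (a / b) powi t)" for s t
  proof -
    have "?f (s + t, s - t) = p powi ((s + t)\<^sup>2 + (s - t)\<^sup>2) * (a powi (s + t) * b powi (s - t))"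
      using assms by (simp add: power_int_add)
    also have "\<dots> = ((p\<^sup>2) powi (s\<^sup>2) * (a * b) powi s) * ((p\<^sup>2) powi (t\<^sup>2) * (a / b) powi t)"
      unfolding e1 pp using assms
      by (simp add: power_int_add power_int_diff power_int_mult_distrib power_int_divide_distrib powi_double)
    finally show ?thesis .
  qed
  have g2: "?f (s + t + 1, s - t) = p * a *
     (((p\<^sup>2) powi (s\<^sup>2) * (p\<^sup>2 * (a * b)) powi s) * ((p\<^sup>2) powi (t\<^sup>2) * (p\<^sup>2 * (a / b)) powi t))" for s t
  proof -
    have "?f (s + t + 1, s - t) = p powi ((s + t + 1)\<^sup>2 + (s - t)\<^sup>2) * (a powi (s + t + 1) * b powi (s - t))"
      using assms by (simp add: power_int_add)
    also have "\<dots> = p * a *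
     (((p\<^sup>2) powi (s\<^sup>2) * (p\<^sup>2 * (a * b)) powi s) * ((p\<^sup>2) powi (t\<^sup>2) * (p\<^sup>2 * (a / b)) powi t))"
      unfolding e1 power_int_mult_distrib[of "p\<^sup>2"] pp using assms
      by (simp add: power_int_add power_int_diff power_int_mult_distrib power_int_divide_distrib powi_double)
    finally show ?thesis .
  qed
  have "(?f has_sum (jtheta (p\<^sup>2) (a * b) * jtheta (p\<^sup>2) (a / b)
    + p * a * (jtheta (p\<^sup>2) (p\<^sup>2 * (a * b)) * jtheta (p\<^sup>2) (p\<^sup>2 * (a / b))))) UNIV"
  proof (rule has_sum_even_odd_int)
    show "((\<lambda>(s, t). ?f (s + t, s - t)) has_sum (jtheta (p\<^sup>2) (a * b) * jtheta (p\<^sup>2) (a / b))) UNIV"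
      using 2 unfolding g1 by simp
    show "((\<lambda>(s, t). ?f (s + t + 1, s - t)) has_sum
      (p * a * (jtheta (p\<^sup>2) (p\<^sup>2 * (a * b)) * jtheta (p\<^sup>2) (p\<^sup>2 * (a / b))))) UNIV"
      using 3 unfolding g2 by (simp add: case_prod_unfold)
  qed
  with 1 show ?thesis
    using has_sum_unique by blast
qed

lemma isCont_jtheta:
  assumes "norm q < 1" "v \<noteq> 0"
  shows "isCont (jtheta q) v"
proof -
  have s: "summable (\<lambda>n. q ^ (n\<^sup>2) * y ^ n)" for y
    by (rule summable_norm_cancel[OF summable_norm_square_power[OF assms(1)]])
  have c: "isCont (\<lambda>y. \<Sum>n. q ^ (n\<^sup>2) * y ^ n) y" for y
    by (rule isCont_powser_converges_everywhere[OF s])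
  have "isCont (\<lambda>v. (\<Sum>n. q ^ (n\<^sup>2) * v ^ n) + (\<Sum>n. q ^ (n\<^sup>2) * inverse v ^ n) - 1) v"
    using isCont_o2[OF continuous_at_within_inverse[OF continuous_ident assms(2)] c] c
    by (intro continuous_intros) auto
  thus ?thesis
    using jtheta_conv_suminf[OF assms(1)] by presburger
qed

section \<open>The Lambert series\<close>

text \<open>The odd number \<open>2 * k + 1\<close> is the summation index of the theorem: the
  Kronecker symbol vanishes at even numbers and equals \<open>(-1) ^ k\<close> there. Up to a
  monomial, one of the two exponentials in each cosine becomes a power of \<open>v\<close>.\<close>

definition lambert :: "complex \<Rightarrow> complex \<Rightarrow> complex"
  where "lambert q v = (\<Sum>k. (-1) ^ k * (q ^ (2 * k + 1) / (1 - q ^ (2 * k + 1))) * v ^ k)"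

text \<open>With \<open>v = exp (4 * \<i> * x)\<close>, the function \<open>2 * qsec q v / exp (2 * \<i> * x)\<close> is
  \<open>1 / cos (2 * x)\<close> plus four times the \<open>x\<close>-part of the Lambert series of the theorem.\<close>

definition qsec :: "complex \<Rightarrow> complex \<Rightarrow> complex"
  where "qsec q v = v / (1 + v) + lambert q (inverse v) + v * lambert q v"

text \<open>The coefficient of \<open>v ^ 0\<close> in the expansion of
  \<open>jtheta q (q * v) * qsec q v\<close> for \<open>1 < |v| < |q|^(-2)\<close>.\<close>

definition qsec_const :: "complex \<Rightarrow> complex"
  where "qsec_const q = (\<Sum>\<^sub>\<infinity>k. (-1) powi k * q powi (k\<^sup>2 + k) / (1 - q powi (2 * k + 1)))"

lemma power_Suc_neq_1: "norm q < 1 \<Longrightarrow> q ^ Suc n \<noteq> 1" for q :: complex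
  by (metis norm_one norm_power order_less_irrefl power_Suc_less_one norm_ge_zero
      zero_less_norm_iff norm_zero power_0_Suc zero_neq_one)

lemma powi_neq_1:
  fixes q :: complex
  assumes "norm q < 1" "q \<noteq> 0" "j \<noteq> 0"
  shows "q powi j \<noteq> 1"
proof (cases "j > 0")
  case True
  then obtain n where "j = int (Suc n)"
    by (metis gr0_implies_Suc zero_less_imp_eq_int)
  thus ?thesis
    using power_Suc_neq_1[OF assms(1), of n] by (simp only: power_int_of_nat not_False_eq_True)
next
  case False
  then obtain n where "j = - int (Suc n)"
    using assms(3) by (metis gr0_implies_Suc zero_less_imp_eq_int neg_0_less_iff_less
      linorder_neqE_linordered_idom minus_minus)
  thus ?thesis
    using power_Suc_neq_1[OF assms(1), of n]
    by (metis inverse_1 inverse_inverse_eq power_int_minus power_int_of_nat)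
qed

text \<open>The denominator stays at distance at least \<open>1 - norm q\<close> from 0, so the
  coefficients decay like \<open>|q|^(2 * k)\<close>. This gives convergence for
  \<open>|v| < |q|^(-2)\<close>.\<close>

lemma norm_lambert_coeff_le:
  fixes q :: complex
  assumes "norm q < 1"
  shows "norm (q ^ (2 * k + 1) / (1 - q ^ (2 * k + 1))) \<le> norm q / (1 - norm q) * ((norm q)\<^sup>2) ^ k"
proof -
  have "norm q ^ (2 * k + 1) \<le> norm q ^ 1"
    using assms by (intro power_decreasing) auto
  hence "1 - norm q \<le> 1 - norm (q ^ (2 * k + 1))"
    by (simp add: norm_power norm_mult)
  also have "\<dots> \<le> norm (1 - q ^ (2 * k + 1))"
    by (metis norm_one norm_triangle_ineq2)
  finally have *: "1 - norm q \<le> norm (1 - q ^ (2 * k + 1))" .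
  have "norm (q ^ (2 * k + 1) / (1 - q ^ (2 * k + 1))) \<le> norm (q ^ (2 * k + 1)) / (1 - norm q)"
    unfolding norm_divide using assms * by (intro divide_left_mono mult_pos_pos) auto
  also have "\<dots> = norm q / (1 - norm q) * ((norm q)\<^sup>2) ^ k"
    by (simp add: norm_power norm_mult power_mult)
  finally show ?thesis .
qed

lemma summable_norm_lambert:
  fixes q v :: complex
  assumes "norm q < 1" "(norm q)\<^sup>2 * norm v < 1"
  shows "summable (\<lambda>k. norm ((-1) ^ k * (q ^ (2 * k + 1) / (1 - q ^ (2 * k + 1))) * v ^ k))"
proof (rule summable_comparison_test')
  show "summable (\<lambda>k. norm q / (1 - norm q) * ((norm q)\<^sup>2 * norm v) ^ k)"
    using assms by (intro summable_mult summable_geometric) simp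
  fix k :: nat
  have "norm (norm ((-1) ^ k * (q ^ (2 * k + 1) / (1 - q ^ (2 * k + 1))) * v ^ k)) =
      norm (q ^ (2 * k + 1) / (1 - q ^ (2 * k + 1))) * norm v ^ k"
    by (simp only: norm_mult norm_power norm_minus_cancel norm_one power_one mult_1 real_norm_def abs_mult abs_norm_cancel power_abs abs_minus_cancel abs_one)
  also have "\<dots> \<le> norm q / (1 - norm q) * ((norm q)\<^sup>2) ^ k * norm v ^ k"
    using norm_lambert_coeff_le[OF assms(1), of k] by (rule mult_right_mono) simp
  finally show "norm (norm ((-1) ^ k * (q ^ (2 * k + 1) / (1 - q ^ (2 * k + 1))) * v ^ k))
      \<le> norm q / (1 - norm q) * ((norm q)\<^sup>2 * norm v) ^ k"
    by (simp only: power_mult_distrib mult.assoc)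
qed

lemmas summable_lambert = summable_norm_cancel[OF summable_norm_lambert]

lemma isCont_lambert:
  assumes "norm q < 1" "(norm q)\<^sup>2 * norm v < 1"
  shows "isCont (lambert q) v"
proof -
  \<comment> \<open>Continuity of a power series at \<open>v\<close> follows from convergence at a
    point of larger modulus. \<open>K\<close> lies strictly between \<open>norm v\<close> and
    \<open>1 / (norm q)^2\<close>; for \<open>q = 0\<close> that quotient is no bound, and any
    larger number serves.\<close>
  obtain K :: real where K: "norm v < K" "(norm q)\<^sup>2 * K < 1"
  proof (cases "q = 0")
    case True
    thus ?thesis using that[of "norm v + 1"] by simp
  next
    case False
    hence "norm v < 1 / (norm q)\<^sup>2"
      using assms by (simp add: field_simps)
    then obtain K where "norm v < K" "K < 1 / (norm q)\<^sup>2"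
      using dense by blast
    thus ?thesis using that[of K] False by (simp add: field_simps)
  qed
  have "K \<ge> 0"
    using K(1) norm_ge_zero[of v] by linarith
  hence "norm (of_real K :: complex) = K"
    by simp
  hence "isCont (\<lambda>v. \<Sum>k. (-1) ^ k * (q ^ (2 * k + 1) / (1 - q ^ (2 * k + 1))) * v ^ k) v"
    using K assms(1)
    by (intro isCont_powser[of _ "of_real K"] summable_lambert) auto
  thus ?thesis
    unfolding lambert_def .
qed

lemma isCont_qsec:
  assumes "norm q < 1" "(norm q)\<^sup>2 * norm v < 1" "(norm q)\<^sup>2 < norm v" "v \<noteq> - 1"
  shows "isCont (qsec q) v"
proof -
  have v: "v \<noteq> 0" "1 + v \<noteq> 0"
    using assms by (auto simp: add_eq_0_iff)
  have "(norm q)\<^sup>2 * norm (inverse v) < 1"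
    using assms(3) v by (simp add: norm_inverse norm_divide field_simps)
  hence "isCont (\<lambda>v. lambert q (inverse v)) v"
    by (rule isCont_o2[OF continuous_at_within_inverse[OF continuous_ident v(1)] isCont_lambert[OF assms(1)]])
  hence "isCont (\<lambda>v. v / (1 + v) + lambert q (inverse v) + v * lambert q v) v"
    using isCont_lambert[OF assms(1,2)] v by (intro continuous_intros) auto
  thus ?thesis
    unfolding qsec_def .
qed

text \<open>Inversion exchanges the two Lambert series, and
  \<open>v * (1 / v) / (1 + 1 / v) = v / (1 + v)\<close>. In the variable \<open>x\<close> this is
  the evenness of the secant and the cosines.\<close>

lemma qsec_inverse:
  assumes "v \<noteq> 0" "v \<noteq> - 1"
  shows "v * qsec q (inverse v) = qsec q v"
proof -
  have "1 + v \<noteq> 0"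
    using assms by (auto simp: add_eq_0_iff)
  hence "v * (inverse v / (1 + inverse v)) = v / (1 + v)"
    using assms by (simp add: field_simps)
  moreover have "v * qsec q (inverse v) = v * (inverse v / (1 + inverse v)) +
      v * lambert q v + (v * inverse v) * lambert q (inverse v)"
    by (simp add: qsec_def algebra_simps)
  ultimately show ?thesis
    using assms by (simp add: qsec_def)
qed

text \<open>With \<open>Q = q ^ (2 * k + 1)\<close>, the nonnegative indices split by
  \<open>1 / (1 - Q) = 1 + Q / (1 - Q)\<close> into a geometric series with sum
  \<open>v / (1 + v)\<close>, which needs \<open>|v| > 1\<close>, and a Lambert series. For the
  negative indices \<open>1 / (1 - 1 / Q) = - Q / (1 - Q)\<close> gives the other Lambert
  series.\<close>

lemma has_sum_qsec:
  assumes q: "norm q < 1" "q \<noteq> 0" and v: "norm v > 1" "(norm q)\<^sup>2 * norm v < 1"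
  shows "((\<lambda>k. (-1) powi k * inverse v powi k / (1 - q powi (2 * k + 1))) has_sum qsec q v) UNIV"
proof -
  let ?f = "\<lambda>k. (-1) powi k * inverse v powi k / (1 - q powi (2 * k + 1))"
  let ?c = "\<lambda>k. (-1) ^ k * (q ^ (2 * k + 1) / (1 - q ^ (2 * k + 1)))"
  have v0: "v \<noteq> 0" and v1: "norm (inverse v) < 1"
    using v by (auto simp: norm_inverse inverse_less_1_iff)
  have iv: "(norm q)\<^sup>2 * norm (inverse v) < 1"
  proof -
    have "(norm q)\<^sup>2 * norm (inverse v) \<le> 1 * norm (inverse v)"
      using q by (intro mult_right_mono power_le_one) auto
    thus ?thesis using v1 by simp
  qed
  have q1: "1 - q ^ (2 * k + 1) \<noteq> 0" for k
    using power_Suc_neq_1[OF q(1), of "2 * k"] by simp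
  have pos: "?f (int k) = (- inverse v) ^ k + ?c k * inverse v ^ k" for k
  proof -
    have "2 * int k + 1 = int (2 * k + 1)"
      by simp
    hence "q powi (2 * int k + 1) = q ^ (2 * k + 1)"
      by (simp only: power_int_of_nat)
    hence "?f (int k) = (-1) ^ k * inverse v ^ k * (1 / (1 - q ^ (2 * k + 1)))"
      by (simp only: power_int_of_nat times_divide_eq_right mult_1_right)
    also have "1 / (1 - q ^ (2 * k + 1)) = 1 + q ^ (2 * k + 1) / (1 - q ^ (2 * k + 1))"
      using q1[of k] by (simp add: field_simps)
    also have "(-1) ^ k * inverse v ^ k * \<dots> = (- inverse v) ^ k + ?c k * inverse v ^ k"
      by (simp only: power_minus[of "inverse v"] ring_distribs mult_1_right mult_1_left mult_ac)
    finally show ?thesis .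
  qed
  have neg: "?f (- int k - 1) = v * (?c k * v ^ k)" for k
  proof -
    have "2 * (- int k - 1) + 1 = - int (2 * k + 1)"
      by simp
    hence "q powi (2 * (- int k - 1) + 1) = inverse (q ^ (2 * k + 1))"
      by (simp only: power_int_minus power_int_of_nat)
    hence "?f (- int k - 1) = - ((-1) ^ k * v ^ Suc k * (1 / (1 - inverse (q ^ (2 * k + 1)))))"
      by (simp add: powi_uminus_Suc)
    also have "1 / (1 - inverse (q ^ (2 * k + 1))) = - (q ^ (2 * k + 1) / (1 - q ^ (2 * k + 1)))"
      using q1[of k] q by (simp add: divide_simps) (simp add: algebra_simps)
    finally show ?thesis
      by simp
  qed
  have g: "(\<lambda>k. (- inverse v) ^ k) sums (v / (1 + v))"
  proof -
    have "1 + v \<noteq> 0"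
      using v by (metis add_eq_0_iff less_irrefl norm_minus_cancel norm_one)
    hence "1 / (1 - (- inverse v)) = v / (1 + v)"
      using v0 by (simp add: field_simps)
    thus ?thesis
      using geometric_sums[of "- inverse v"] v1 by simp
  qed
  have G: "(\<lambda>k. ?c k * u ^ k) sums lambert q u" if "(norm q)\<^sup>2 * norm u < 1" for u
    unfolding lambert_def by (rule summable_sums[OF summable_lambert[OF q(1) that]])
  have "(?f has_sum ((v / (1 + v) + lambert q (inverse v)) + v * lambert q v)) UNIV"
  proof (rule has_sum_int_split; rule norm_summable_imp_has_sum)
    show "(\<lambda>k. ?f (int k)) sums (v / (1 + v) + lambert q (inverse v))"
      unfolding pos by (rule sums_add[OF g G[OF iv]])
    show "(\<lambda>k. ?f (- int k - 1)) sums (v * lambert q v)"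
      unfolding neg by (rule sums_mult[OF G[OF v(2)]])
    show "summable (\<lambda>k. norm (?f (- int k - 1)))"
      unfolding neg norm_mult[of v]
      by (rule summable_mult[OF summable_norm_lambert[OF q(1) v(2)]])
    show "summable (\<lambda>k. norm (?f (int k)))"
      unfolding pos
    proof (rule summable_comparison_test')
      show "summable (\<lambda>k. norm ((- inverse v) ^ k) + norm (?c k * inverse v ^ k))"
        using v1 by (intro summable_add summable_norm_lambert[OF q(1) iv])
          (simp add: norm_power summable_geometric)
      show "norm (norm ((- inverse v) ^ k + ?c k * inverse v ^ k)) \<le>
          norm ((- inverse v) ^ k) + norm (?c k * inverse v ^ k)" for k
        by (simp only: real_norm_def abs_norm_cancel) (rule norm_triangle_ineq)
    qed
  qed
  thus ?thesis
    unfolding qsec_def .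
qed

section \<open>The product of the theta function with the bilateral series\<close>

text \<open>The reflection of \<open>k\<close> to \<open>1 - 2 * m - k\<close> sends
  \<open>m + k\<close> to \<open>1 - (m + k)\<close>. It preserves the exponent of \<open>q\<close>
  and changes the parity of \<open>k\<close>, so the sum equals its own negative.\<close>

lemma alternating_pronic_infsum_eq_0:
  "(\<Sum>\<^sub>\<infinity>k. (-1) powi k * q powi ((m + k)\<^sup>2 - (m + k))) = 0" for q :: complex
proof -
  let ?s = "\<lambda>k. (-1) powi k * q powi ((m + k)\<^sup>2 - (m + k))"
  have "infsum ?s UNIV = (\<Sum>\<^sub>\<infinity>k. - ?s k)"
  proof (rule infsum_reindex_bij_witness[of _ "\<lambda>k. 1 - 2 * m - k" "\<lambda>k. 1 - 2 * m - k"])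
    fix k
    have "(m + (1 - 2 * m - k))\<^sup>2 - (m + (1 - 2 * m - k)) = (m + k)\<^sup>2 - (m + k)"
      by (simp add: power2_eq_square algebra_simps)
    thus "- ?s (1 - 2 * m - k) = ?s k"
      by (simp only: power_int_minus_left) simp
  qed auto
  also have "\<dots> = - infsum ?s UNIV"
    by (rule infsum_uminus)
  finally show ?thesis
    by simp
qed

lemma jtheta_mult_qsec_outside:
  assumes q: "norm q < 1" "q \<noteq> 0" and v: "norm v > 1" "(norm q)\<^sup>2 * norm v < 1"
  shows "jtheta q (q * v) * qsec q v = qsec_const q * jtheta q v"
proof -
  have v0: "v \<noteq> 0"
    using v by auto
  \<comment> \<open>The substitution \<open>n = m + k\<close> collects equal powers of
    \<open>v\<close>: \<open>v^n * v^(-k) = v^m\<close>, and \<open>q^(n^2) * q^n\<close> becomes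
    the numerator of \<open>t m k\<close>.\<close>
  define t where "t m k = (-1) powi k * q powi ((m + k)\<^sup>2 + (m + k)) / (1 - q powi (2 * k + 1))" for m k
  let ?f = "\<lambda>(n, k). (q powi (n\<^sup>2) * (q * v) powi n) *
     ((-1) powi k * inverse v powi k / (1 - q powi (2 * k + 1)))"
  let ?g = "\<lambda>(m, k). v powi m * t m k"
  have "(?f has_sum (jtheta q (q * v) * qsec q v)) (UNIV \<times> UNIV)"
    by (intro has_sum_mult_complex has_sum_jtheta has_sum_qsec q v)
  also have "?this \<longleftrightarrow> (?g has_sum (jtheta q (q * v) * qsec q v)) (UNIV \<times> UNIV)"
  proof (rule has_sum_reindex_bij_witness[of _ "\<lambda>(m, k). (m + k, k)" "\<lambda>(n, k). (n - k, k)"])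
    fix z :: "int \<times> int"
    obtain n k where z: "z = (n, k)"
      by force
    have e: "v powi (n - k) = v powi n * inverse v powi k" "n - k + k = n"
      using v0 by (simp_all add: power_int_diff power_int_inverse field_simps)
    have "?g (case z of (n, k) \<Rightarrow> (n - k, k)) =
        v powi n * inverse v powi k * ((-1) powi k * (q powi (n\<^sup>2) * q powi n) / (1 - q powi (2 * k + 1)))"
      using q(2) by (simp only: z prod.case t_def e power_int_add[of q "n\<^sup>2" n, OF disjI1] not_False_eq_True)
    thus "?g (case z of (n, k) \<Rightarrow> (n - k, k)) = ?f z"
      by (simp add: z power_int_mult_distrib)
  qed auto
  finally have g: "(?g has_sum (jtheta q (q * v) * qsec q v)) (UNIV \<times> UNIV)" .
  have ts: "t m summable_on UNIV" for m
  proof -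
    have "(\<lambda>k. v powi m * t m k) summable_on UNIV"
      by (rule summable_on_SigmaD1[OF has_sum_imp_summable[OF g]]) simp
    hence "(\<lambda>k. inverse (v powi m) * (v powi m * t m k)) summable_on UNIV"
      by (rule summable_on_cmult_right)
    thus ?thesis
      using v0 by (simp add: field_simps)
  qed
  define C where "C m = infsum (t m) UNIV" for m
  have tC: "(t m has_sum C m) UNIV" for m
    unfolding C_def by (rule has_sum_infsum[OF ts])
  \<comment> \<open>The factor \<open>1 - q powi (2 * k + 1)\<close> cancels in the difference of consecutive coefficients.\<close>
  have rec: "C m = q powi (2 * m - 1) * C (m - 1)" for m
  proof -
    have d: "t m k + - (q powi (2 * m - 1)) * t (m - 1) k =
        - (q powi (2 * m - 1)) * ((-1) powi k * q powi ((m + k)\<^sup>2 - (m + k)))" for k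
    proof -
      have e: "(m + k)\<^sup>2 + (m + k) = (2 * m - 1) + (((m + k)\<^sup>2 - (m + k)) + (2 * k + 1))"
        "(m - 1 + k)\<^sup>2 + (m - 1 + k) = (m + k)\<^sup>2 - (m + k)"
        by (simp_all add: power2_eq_square algebra_simps)
      have "2 * k + 1 \<noteq> 0"
        by presburger
      hence "1 - q powi (2 * k + 1) \<noteq> 0"
        using powi_neq_1[OF q, of "2 * k + 1"] by simp
      thus ?thesis
        unfolding t_def e power_int_add[of q "2 * m - 1", OF disjI1[OF q(2)]]
          power_int_add[of q "(m + k)\<^sup>2 - (m + k)", OF disjI1[OF q(2)]]
        by (simp add: divide_simps) (simp add: algebra_simps)
    qed
    have "((\<lambda>k. t m k + - (q powi (2 * m - 1)) * t (m - 1) k) has_sum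
        (C m + - (q powi (2 * m - 1)) * C (m - 1))) UNIV"
      by (intro has_sum_add has_sum_cmult_right tC)
    hence "C m + - (q powi (2 * m - 1)) * C (m - 1) =
        (\<Sum>\<^sub>\<infinity>k. - (q powi (2 * m - 1)) * ((-1) powi k * q powi ((m + k)\<^sup>2 - (m + k))))"
      unfolding d by (rule infsumI[symmetric])
    also have "\<dots> = 0"
      by (simp only: infsum_cmult_right' alternating_pronic_infsum_eq_0 mult_zero_right)
    finally show ?thesis
      by simp
  qed
  \<comment> \<open>Since \<open>2 * m - 1 = m^2 - (m - 1)^2\<close>, the recurrence telescopes from
    0 in both directions.\<close>
  have C: "C m = q powi (m\<^sup>2) * C 0" for m
  proof (induction m rule: int_induct[where k = 0])
    case (step1 i)
    have "(i + 1)\<^sup>2 = (2 * (i + 1) - 1) + i\<^sup>2"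
      by (simp add: power2_eq_square algebra_simps)
    thus ?case
      using rec[of "i + 1"] step1(2) q(2) by (simp add: power_int_add del: mult_minus_right)
  next
    case (step2 i)
    have "i\<^sup>2 = (2 * i - 1) + (i - 1)\<^sup>2"
      by (simp add: power2_eq_square algebra_simps)
    hence "q powi (2 * i - 1) * C (i - 1) = q powi (2 * i - 1) * (q powi ((i - 1)\<^sup>2) * C 0)"
      using rec[of i] step2(2) power_int_add[of q "2 * i - 1" "(i - 1)\<^sup>2"] q(2) by simp
    thus ?case
      using q(2) by simp
  qed simp
  have "((\<lambda>m. v powi m * C m) has_sum (jtheta q (q * v) * qsec q v)) UNIV"
  proof (rule has_sum_Sigma'[OF g])
    show "((\<lambda>k. ?g (m, k)) has_sum (v powi m * C m)) UNIV" for m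
      using has_sum_cmult_right[OF tC, of "v powi m"] by simp
  qed
  moreover have "((\<lambda>m. C 0 * (q powi (m\<^sup>2) * v powi m)) has_sum (C 0 * jtheta q v)) UNIV"
    by (intro has_sum_cmult_right has_sum_jtheta q)
  moreover have "(\<lambda>m. v powi m * C m) = (\<lambda>m. C 0 * (q powi (m\<^sup>2) * v powi m))"
    by (subst C) (simp add: mult_ac)
  moreover have "C 0 = qsec_const q"
    by (simp add: C_def qsec_const_def t_def[abs_def])
  ultimately show ?thesis
    using has_sum_unique by metis
qed

lemma jtheta_mult_qsec:
  assumes q: "norm q < 1" "q \<noteq> 0" and v: "(norm q)\<^sup>2 < norm v" "(norm q)\<^sup>2 * norm v < 1" "v \<noteq> - 1"
  shows "jtheta q (q * v) * qsec q v = qsec_const q * jtheta q v"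
proof -
  have v0: "v \<noteq> 0"
    using v by auto
  consider "norm v > 1" | "norm v < 1" | "norm v = 1"
    by linarith
  thus ?thesis
  proof cases
    case 1
    thus ?thesis
      using jtheta_mult_qsec_outside q v by blast
  next
    \<comment> \<open>Here \<open>1 / v\<close> lies in the outer annulus. Reflection of
      \<open>jtheta q (q / v)\<close> supplies exactly the factor \<open>v\<close> that turns
      \<open>qsec q (1 / v)\<close> into \<open>qsec q v\<close>.\<close>
    case 2
    have "norm (inverse v) > 1" "(norm q)\<^sup>2 * norm (inverse v) < 1"
      using 2 v v0 by (auto simp: norm_inverse norm_divide field_simps)
    from jtheta_mult_qsec_outside[OF q this]
    have "jtheta q (q * v) * (v * qsec q (inverse v)) = qsec_const q * jtheta q v"
      using q v0 by (simp add: jtheta_q_inverse jtheta_inverse mult_ac)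
    thus ?thesis
      using v v0 by (simp add: qsec_inverse)
  next
    case 3
    have q2: "(norm q)\<^sup>2 < 1"
      using q by (simp add: power_less_one_iff)
    \<comment> \<open>The point on the unit circle is approached radially from outside, where the
      identity is known; \<open>v \<noteq> -1\<close> keeps \<open>qsec q\<close> continuous
      there.\<close>
    define w where "w t = of_real t * v" for t :: real
    have w: "(w \<longlongrightarrow> v) (at_right 1)"
    proof -
      have "((\<lambda>t. of_real t * v) \<longlongrightarrow> of_real 1 * v) (at_right 1)"
        by (intro tendsto_intros)
      thus ?thesis by (simp add: w_def[abs_def])
    qed
    have 1: "((\<lambda>t. jtheta q (q * w t) * qsec q (w t)) \<longlongrightarrow> jtheta q (q * v) * qsec q v) (at_right 1)"
      using q v v0 by (intro tendsto_mult isCont_tendsto_compose[OF isCont_jtheta] tendsto_const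
        isCont_tendsto_compose[OF isCont_qsec] w) auto
    have 2: "((\<lambda>t. qsec_const q * jtheta q (w t)) \<longlongrightarrow> qsec_const q * jtheta q v) (at_right 1)"
      using q v v0 by (intro tendsto_mult isCont_tendsto_compose[OF isCont_jtheta] tendsto_const w) auto
    have "eventually (\<lambda>t. jtheta q (q * w t) * qsec q (w t) = qsec_const q * jtheta q (w t)) (at_right 1)"
    proof -
      have "1 < 1 / (norm q)\<^sup>2"
        using q q2 by (simp add: field_simps)
      hence "eventually (\<lambda>t. t \<in> {1<..<1 / (norm q)\<^sup>2}) (at_right 1)"
        by (rule eventually_at_right_real)
      thus ?thesis
      proof eventually_elim
        case (elim t)
        hence "norm (w t) = t" "1 < t" "(norm q)\<^sup>2 * t < 1"
          using 3 q by (auto simp: w_def norm_mult field_simps)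
        thus ?case
          using jtheta_mult_qsec_outside[OF q, of "w t"] by simp
      qed
    qed
    hence "((\<lambda>t. jtheta q (q * w t) * qsec q (w t)) \<longlongrightarrow> qsec_const q * jtheta q v) (at_right 1)"
      using 2 by (simp only: tendsto_cong)
    thus ?thesis
      using tendsto_unique[OF trivial_limit_at_right_real 1] by blast
  qed
qed

section \<open>Evaluation of the constant\<close>

lemma norm_suminf_minus_1_le:
  fixes c :: "nat \<Rightarrow> complex"
  assumes "c 0 = 1" "\<And>n. norm (c n) \<le> r ^ n" "0 \<le> r" "r < 1"
  shows "norm (suminf c - 1) \<le> r / (1 - r)"
proof -
  have s: "summable (\<lambda>n. norm (c n))"
    by (rule summable_comparison_test'[of "\<lambda>n. r ^ n"]) (use assms in \<open>auto simp: summable_geometric\<close>)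
  have g: "(\<lambda>n. r ^ Suc n) sums (r / (1 - r))"
    using sums_mult[OF geometric_sums[of r], of r] assms by simp
  have s': "summable (\<lambda>n. norm (c (Suc n)))"
    by (subst summable_Suc_iff) (rule s)
  have "suminf c - 1 = (\<Sum>n. c (Suc n))"
    using suminf_split_head[OF summable_norm_cancel[OF s]] assms(1) by simp
  also have "norm \<dots> \<le> (\<Sum>n. norm (c (Suc n)))"
    by (rule summable_norm[OF s'])
  also have "\<dots> \<le> (\<Sum>n. r ^ Suc n)"
    by (rule suminf_le[OF assms(2) s' sums_summable[OF g]])
  also have "\<dots> = r / (1 - r)"
    by (rule sums_unique[OF g, symmetric])
  finally show ?thesis .
qed

lemma norm_jtheta_minus_1_le:
  assumes "norm q < 1" "norm v = 1"
  shows "norm (jtheta q v - 1) \<le> 2 * (norm q / (1 - norm q))"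
proof -
  have *: "norm ((\<Sum>n. q ^ (n\<^sup>2) * u ^ n) - 1) \<le> norm q / (1 - norm q)" if "norm u = 1" for u
  proof (rule norm_suminf_minus_1_le)
    show "norm (q ^ (n\<^sup>2) * u ^ n) \<le> norm q ^ n" for n
      using assms(1) that
      by (simp add: norm_mult norm_power power_decreasing power2_nat_le_imp_le power2_eq_square)
  qed (use assms in auto)
  have "jtheta q v - 1 = ((\<Sum>n. q ^ (n\<^sup>2) * v ^ n) - 1) + ((\<Sum>n. q ^ (n\<^sup>2) * inverse v ^ n) - 1)"
    using jtheta_conv_suminf[OF assms(1), of v] by simp
  also have "norm \<dots> \<le> norm q / (1 - norm q) + norm q / (1 - norm q)"
    using *[of v] *[of "inverse v"] assms(2) by (intro norm_triangle_mono) (auto simp: norm_inverse)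
  finally show ?thesis
    by simp
qed

text \<open>At \<open>v = q\<close> the terms with indices \<open>n\<close> and
  \<open>- n - 1\<close> both equal \<open>q ^ (n^2 + n)\<close>. The sum is therefore twice a
  series beginning with 1, which explains the limit 2.\<close>

lemma norm_jtheta_q_minus_2_le:
  assumes "norm q < 1" "q \<noteq> 0"
  shows "norm (jtheta q q - 2) \<le> 2 * (norm q / (1 - norm q))"
proof -
  have e: "q ^ ((Suc n)\<^sup>2) * inverse q ^ Suc n = q ^ (n\<^sup>2) * q ^ n" for n
  proof -
    have "q ^ ((Suc n)\<^sup>2) = q ^ (n\<^sup>2) * q ^ n * q ^ Suc n"
      by (simp add: power2_eq_square add_ac flip: power_add power_Suc)
    thus ?thesis
      using assms(2) by (simp add: power_inverse del: power_Suc)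
  qed
  have "jtheta q q - 2 = 2 * ((\<Sum>n. q ^ (n\<^sup>2) * q ^ n) - 1)"
    using jtheta_eqI[OF assms(1) has_sum_jtheta_aux[OF assms(1)], of q] unfolding e by simp
  moreover have "norm ((\<Sum>n. q ^ (n\<^sup>2) * q ^ n) - 1) \<le> norm q / (1 - norm q)"
  proof (rule norm_suminf_minus_1_le)
    show "norm (q ^ (n\<^sup>2) * q ^ n) \<le> norm q ^ n" for n
      using assms(1) by (simp add: norm_mult norm_power mult_left_le_one_le power_le_one)
  qed (use assms in auto)
  ultimately show ?thesis
    by (simp only: norm_mult norm_numeral)
qed

lemma norm_lambert_1_le:
  assumes "norm q < 1"
  shows "norm (lambert q 1) \<le> norm q / (1 - norm q) * (1 / (1 - (norm q)\<^sup>2))"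
proof -
  let ?c = "\<lambda>k. (-1) ^ k * (q ^ (2 * k + 1) / (1 - q ^ (2 * k + 1))) * 1 ^ k"
  have q2: "(norm q)\<^sup>2 < 1"
    using assms by (simp add: power_less_one_iff)
  have s: "summable (\<lambda>k. norm (?c k))"
    using summable_norm_lambert[OF assms, of 1] q2 by simp
  have g: "(\<lambda>k. norm q / (1 - norm q) * ((norm q)\<^sup>2) ^ k) sums (norm q / (1 - norm q) * (1 / (1 - (norm q)\<^sup>2)))"
    using q2 by (intro sums_mult geometric_sums) simp
  have "norm (lambert q 1) \<le> (\<Sum>k. norm (?c k))"
    unfolding lambert_def by (rule summable_norm[OF s])
  also have "\<dots> \<le> (\<Sum>k. norm q / (1 - norm q) * ((norm q)\<^sup>2) ^ k)"
  proof (rule suminf_le[OF _ s sums_summable[OF g]])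
    show "norm (?c k) \<le> norm q / (1 - norm q) * ((norm q)\<^sup>2) ^ k" for k
      using norm_lambert_coeff_le[OF assms, of k]
      by (simp only: norm_mult norm_power norm_minus_cancel norm_one power_one mult_1 mult_1_right)
  qed
  also have "\<dots> = norm q / (1 - norm q) * (1 / (1 - (norm q)\<^sup>2))"
    by (rule sums_unique[OF g, symmetric])
  finally show ?thesis .
qed

section \<open>Limits along nomes tending to zero\<close>

context
  fixes Q :: "nat \<Rightarrow> complex"
  assumes Q: "\<And>k. norm (Q k) < 1" "\<And>k. Q k \<noteq> 0" "Q \<longlonglongrightarrow> 0"
begin

lemma tendsto_norm_over_one_minus: "(\<lambda>k. 2 * (norm (Q k) / (1 - norm (Q k)))) \<longlonglongrightarrow> 0"
proof -
  have "(\<lambda>k. 2 * (norm (Q k) / (1 - norm (Q k)))) \<longlonglongrightarrow> 2 * (norm (0::complex) / (1 - norm (0::complex)))"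
    by (intro tendsto_intros Q) simp
  thus ?thesis
    by simp
qed

lemma tendsto_jtheta: "norm v = 1 \<Longrightarrow> (\<lambda>k. jtheta (Q k) v) \<longlonglongrightarrow> 1"
  by (rule LIM_zero_cancel, rule Lim_null_comparison[OF _ tendsto_norm_over_one_minus])
     (use Q(1) norm_jtheta_minus_1_le in auto)

lemma tendsto_jtheta_q: "(\<lambda>k. jtheta (Q k) (Q k)) \<longlonglongrightarrow> 2"
  by (rule LIM_zero_cancel, rule Lim_null_comparison[OF _ tendsto_norm_over_one_minus])
     (use Q norm_jtheta_q_minus_2_le in auto)

lemma tendsto_qsec: "(\<lambda>k. qsec (Q k) 1) \<longlonglongrightarrow> 1 / 2"
proof -
  have "(\<lambda>k. norm (Q k) / (1 - norm (Q k)) * (1 / (1 - (norm (Q k))\<^sup>2))) \<longlonglongrightarrow>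
      norm (0::complex) / (1 - norm (0::complex)) * (1 / (1 - (norm (0::complex))\<^sup>2))"
    by (intro tendsto_intros Q) auto
  hence "(\<lambda>k. norm (Q k) / (1 - norm (Q k)) * (1 / (1 - (norm (Q k))\<^sup>2))) \<longlonglongrightarrow> 0"
    by simp
  hence "(\<lambda>k. lambert (Q k) 1) \<longlonglongrightarrow> 0"
    by (rule Lim_null_comparison[rotated]) (use Q(1) norm_lambert_1_le in auto)
  hence "(\<lambda>k. 1 / 2 + lambert (Q k) 1 + lambert (Q k) 1) \<longlonglongrightarrow> 1 / 2 + 0 + 0"
    by (intro tendsto_add tendsto_const)
  thus ?thesis
    by (simp add: qsec_def)
qed

end

section \<open>Iterated squaring of the nome\<close>

lemma doubling_tendsto_0:
  fixes q :: complex
  assumes "norm q < 1"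
  shows "(\<lambda>k. q ^ (2 ^ k)) \<longlonglongrightarrow> 0"
  using LIMSEQ_subseq_LIMSEQ[OF LIMSEQ_power_zero[OF assms], of "\<lambda>k. 2 ^ k"]
  by (simp add: o_def strict_mono_def)

lemma doubling_norm_less_1: "norm q < 1 \<Longrightarrow> norm (q ^ (2 ^ k)) < 1" for q :: complex
  by (simp add: norm_power power_less_one_iff)

lemma doubling_Suc: "q ^ (2 ^ Suc k) = (q ^ (2 ^ k))\<^sup>2" for q :: complex
  by (metis power_Suc2 power_mult)

text \<open>In the product formula with arguments 1 and -1, the odd class contains
  \<open>jtheta (q^2) (- (q^2))\<close>, which is zero by reflection.\<close>

lemma jtheta_1_mult_jtheta_minus_1:
  assumes "norm q < 1" "q \<noteq> 0"
  shows "jtheta q 1 * jtheta q (- 1) = (jtheta (q\<^sup>2) (- 1))\<^sup>2"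
proof -
  have "norm (q\<^sup>2) < 1" "q\<^sup>2 \<noteq> 0"
    using assms by (simp_all add: norm_power power_less_one_iff)
  from jtheta_q_inverse[OF this, of "- 1"] have "jtheta (q\<^sup>2) (- (q\<^sup>2)) = 0"
    by simp
  thus ?thesis
    using jtheta_mult[OF assms, of 1 "- 1"] by (simp add: power2_eq_square)
qed

text \<open>A zero would make \<open>jtheta\<close> vanish at -1 for the nome \<open>q^2\<close>,
  and by the preceding product formula for all its iterated squares. These values tend to 1.\<close>

lemma jtheta_1_nonzero:
  assumes "norm q < 1" "q \<noteq> 0"
  shows "jtheta q 1 \<noteq> 0"
proof
  assume 0: "jtheta q 1 = 0"
  have z: "jtheta (q ^ (2 ^ Suc k)) (- 1) = 0" for k
  proof (induction k)
    case 0
    thus ?case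
      using jtheta_1_mult_jtheta_minus_1[OF assms] \<open>jtheta q 1 = 0\<close> by simp
  next
    case (Suc k)
    thus ?case
      using jtheta_1_mult_jtheta_minus_1[OF doubling_norm_less_1[OF assms(1)], of "Suc k"] assms(2)
      unfolding doubling_Suc[of q "Suc k"] by simp
  qed
  have "(\<lambda>k. jtheta (q ^ (2 ^ k)) (- 1)) \<longlonglongrightarrow> 1"
    using assms by (intro tendsto_jtheta doubling_tendsto_0 doubling_norm_less_1) auto
  hence "(\<lambda>k. jtheta (q ^ (2 ^ Suc k)) (- 1)) \<longlonglongrightarrow> 1"
    by (rule LIMSEQ_Suc)
  thus False
    unfolding z by (simp add: LIMSEQ_const_iff)
qed

text \<open>The product formula with both arguments equal to \<open>p\<close>; quasi-periodicity
  makes the even and odd contributions equal.\<close>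

lemma jtheta_q_squared:
  assumes "norm p < 1" "p \<noteq> 0"
  shows "(jtheta p p)\<^sup>2 = 2 * jtheta (p\<^sup>2) (p\<^sup>2) * jtheta (p\<^sup>2) 1"
proof -
  have p2: "norm (p\<^sup>2) < 1" "p\<^sup>2 \<noteq> 0"
    using assms by (simp_all add: norm_power power_less_one_iff)
  have "p * p * jtheta (p\<^sup>2) (p\<^sup>2 * (p * p)) = jtheta (p\<^sup>2) 1"
    using jtheta_q2_mult[OF p2, of 1] by (simp add: power2_eq_square)
  hence "p * p * (jtheta (p\<^sup>2) (p\<^sup>2 * (p * p)) * jtheta (p\<^sup>2) (p\<^sup>2 * (p / p))) =
      jtheta (p\<^sup>2) 1 * jtheta (p\<^sup>2) (p\<^sup>2)"
    using assms by (simp flip: mult.assoc)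
  thus ?thesis
    using jtheta_mult[OF assms assms(2) assms(2)] assms(2) by (simp add: power2_eq_square)
qed

text \<open>By the squaring formula and \<open>jtheta_1_nonzero\<close>, a zero passes from
  \<open>q\<close> to every iterated square of \<open>q\<close>, against the limit 2.\<close>

lemma jtheta_q_nonzero:
  assumes "norm q < 1" "q \<noteq> 0"
  shows "jtheta q q \<noteq> 0"
proof
  assume 0: "jtheta q q = 0"
  have z: "jtheta (q ^ (2 ^ k)) (q ^ (2 ^ k)) = 0" for k
  proof (induction k)
    case 0
    thus ?case
      using \<open>jtheta q q = 0\<close> by simp
  next
    case (Suc k)
    have "jtheta (q ^ (2 ^ Suc k)) 1 \<noteq> 0"
      using assms by (intro jtheta_1_nonzero doubling_norm_less_1) auto
    thus ?case
      using Suc jtheta_q_squared[OF doubling_norm_less_1[OF assms(1)], of k] assms(2)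
      unfolding doubling_Suc[of q k] by simp
  qed
  have "(\<lambda>k. jtheta (q ^ (2 ^ k)) (q ^ (2 ^ k))) \<longlonglongrightarrow> 2"
    using assms by (intro tendsto_jtheta_q doubling_tendsto_0 doubling_norm_less_1) auto
  thus False
    unfolding z by (simp add: LIMSEQ_const_iff)
qed

text \<open>Let \<open>H\<close> be the sum of \<open>h\<close>. The two lines of computation
  \<open>h1\<close> and \<open>h2\<close> identify \<open>H\<close> with each half of
  \<open>qsec q (1 / q)\<close>, so that this value is \<open>2 * H\<close>. The series
  \<open>h3\<close> shows that passing from nome \<open>q = p^2\<close> to \<open>p\<close> adds
  \<open>p * H\<close> to \<open>lambert q 1\<close>, which occurs twice in
  \<open>qsec q 1\<close>.\<close>

lemma qsec_1_double:
  assumes p: "norm p < 1" "p \<noteq> 0"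
  shows "qsec p 1 = qsec (p\<^sup>2) 1 + p * qsec (p\<^sup>2) (inverse (p\<^sup>2))"
proof -
  define q where "q = p\<^sup>2"
  define h where "h k = (-1) ^ k * (q ^ k / (1 - q ^ (2 * k + 1)))" for k
  let ?c = "\<lambda>q k. (-1) ^ k * (q ^ (2 * k + 1) / (1 - q ^ (2 * k + 1)))"
  have q: "norm q < 1" "q \<noteq> 0"
    using p by (simp_all add: q_def norm_power power_less_one_iff)
  have r2: "(norm r)\<^sup>2 < 1" if "norm r < 1" for r :: complex
    using that by (simp add: power_less_one_iff)
  have G: "(\<lambda>k. ?c r k * u ^ k) sums lambert r u" if "norm r < 1" "(norm r)\<^sup>2 * norm u < 1" for r u
    unfolding lambert_def by (rule summable_sums[OF summable_lambert[OF that]])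
  have q1: "1 - r ^ (2 * k + 1) \<noteq> 0" if "norm r < 1" for k and r :: complex
    using power_Suc_neq_1[OF that, of "2 * k"] by simp
  have n1: "(norm q)\<^sup>2 * norm (inverse q) < 1" "(norm q)\<^sup>2 * norm q < 1"
  proof -
    show "(norm q)\<^sup>2 * norm (inverse q) < 1"
      using q by (simp add: norm_inverse power2_eq_square mult.assoc)
    have "(norm q)\<^sup>2 * norm q \<le> 1 * norm q"
      using r2[OF q(1)] by (intro mult_right_mono) auto
    thus "(norm q)\<^sup>2 * norm q < 1"
      using q(1) by simp
  qed
  have h1: "h sums (inverse q * lambert q (inverse q))"
  proof -
    have "inverse q * (?c q k * inverse q ^ k) = h k" for k
    proof -
      have "q ^ (2 * k + 1) = q ^ k * q ^ k * q"
        by (simp add: mult_2 power_add)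
      hence "inverse q * (q ^ (2 * k + 1) * inverse q ^ k) = q ^ k"
        using q(2) by (simp add: power_inverse field_simps)
      hence "(-1) ^ k * (inverse q * (q ^ (2 * k + 1) * inverse q ^ k) / (1 - q ^ (2 * k + 1))) = h k"
        by (simp only: h_def)
      thus ?thesis
        by (simp only: times_divide_eq_right times_divide_eq_left mult_ac)
    qed
    thus ?thesis
      using sums_mult[OF G[OF q(1) n1(1)], of "inverse q"] by simp
  qed
  have h2: "h sums (1 / (1 + q) + lambert q q)"
  proof -
    have "(- q) ^ k + ?c q k * q ^ k = h k" for k
    proof -
      have "h k = (-1) ^ k * q ^ k * (1 / (1 - q ^ (2 * k + 1)))"
        by (simp add: h_def)
      also have "1 / (1 - q ^ (2 * k + 1)) = 1 + q ^ (2 * k + 1) / (1 - q ^ (2 * k + 1))"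
        using q1[OF q(1), of k] by (simp add: field_simps)
      finally show ?thesis
        by (simp only: power_minus[of q] ring_distribs mult_1_right mult_1_left mult_ac)
    qed
    moreover have "(\<lambda>k. (- q) ^ k) sums (1 / (1 + q))"
      using geometric_sums[of "- q"] q(1) by simp
    ultimately show ?thesis
      using sums_add[OF _ G[OF q(1) n1(2)], of "\<lambda>k. (- q) ^ k"] by simp
  qed
  have h3: "(\<lambda>k. p * h k) sums (lambert p 1 - lambert q 1)"
  proof -
    have "?c p k * 1 ^ k - ?c q k * 1 ^ k = p * h k" for k
    proof -
      \<comment> \<open>The coefficients for the nomes \<open>p\<close> and \<open>p^2\<close> are
        \<open>Q / (1 - Q)\<close> and \<open>Q^2 / (1 - Q^2)\<close> up to sign; their difference
        is \<open>Q / (1 - Q^2)\<close>.\<close>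
      define Q where "Q = p ^ (2 * k + 1)"
      have "q ^ (2 * k + 1) = Q\<^sup>2" "p * q ^ k = Q"
        by (simp_all add: q_def Q_def flip: power_mult) (simp add: mult.commute power2_eq_square flip: power_add)
      moreover have "1 - Q \<noteq> 0" "1 - Q\<^sup>2 \<noteq> 0"
        using q1[OF p(1), of k] q1[OF q(1), of k] unfolding \<open>q ^ (2 * k + 1) = Q\<^sup>2\<close> Q_def by auto
      moreover have "Q / (1 - Q) - Q\<^sup>2 / (1 - Q\<^sup>2) = Q / (1 - Q\<^sup>2)"
        using calculation(3,4) by (simp add: divide_simps) (simp add: power2_eq_square algebra_simps)
      ultimately show ?thesis
        unfolding h_def Q_def[symmetric]
        by (metis (no_types, lifting) mult.left_commute mult_1_right power_one right_diff_distrib times_divide_eq_right)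
    qed
    thus ?thesis
      using sums_diff[OF G[OF p(1), of 1] G[OF q(1), of 1]] r2[OF p(1)] r2[OF q(1)] by simp
  qed
  have "lambert p 1 - lambert q 1 = p * (inverse q * lambert q (inverse q))"
    using sums_unique2[OF h3 sums_mult[OF h1]] .
  moreover have "inverse q * lambert q (inverse q) = 1 / (1 + q) + lambert q q"
    by (rule sums_unique2[OF h1 h2])
  moreover have "inverse q / (1 + inverse q) = 1 / (1 + q)"
    using q(2) by (simp add: field_simps)
  ultimately show ?thesis
    unfolding q_def[symmetric] by (simp add: qsec_def algebra_simps)
qed

text \<open>The quotient of both sides is invariant under \<open>q \<mapsto> q\<^sup>2\<close> and tends to 1 as \<open>q\<close> tends to 0.\<close>

lemma qsec_1:
  assumes q: "norm q < 1" "q \<noteq> 0"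
  shows "2 * qsec q 1 = (jtheta q 1)\<^sup>2"
proof -
  define \<rho> where "\<rho> q = 2 * qsec q 1 / (jtheta q 1)\<^sup>2" for q
  have step: "\<rho> (p\<^sup>2) = \<rho> p" if p: "norm p < 1" "p \<noteq> 0" for p
  proof -
    define r where "r = p\<^sup>2"
    have r: "norm r < 1" "r \<noteq> 0"
      using p by (simp_all add: r_def norm_power power_less_one_iff)
    have r2: "(norm r)\<^sup>2 < 1" "(norm r)\<^sup>2 * norm (inverse r) < 1" "(norm r)\<^sup>2 < norm (inverse r)"
    proof -
      show "(norm r)\<^sup>2 < 1"
        using r by (simp add: power_less_one_iff)
      also have "1 < norm (inverse r)"
        using r by (simp add: norm_inverse one_less_inverse)
      finally show "(norm r)\<^sup>2 < norm (inverse r)" .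
      show "(norm r)\<^sup>2 * norm (inverse r) < 1"
        using r by (simp add: norm_inverse power2_eq_square mult.assoc)
    qed
    have "inverse r \<noteq> - 1"
      using r(1) by (metis inverse_inverse_eq inverse_minus_eq inverse_1 norm_minus_cancel norm_one order_less_irrefl)
    \<comment> \<open>The theta identity is taken at \<open>v = 1 / r\<close>, where
      \<open>r * v = 1\<close>. Together with its case \<open>v = 1\<close> it expresses both values
      in the doubling formula through the same constant.\<close>
    hence 1: "jtheta r 1 * qsec r (inverse r) = qsec_const r * jtheta r r"
      using jtheta_mult_qsec[OF r, of "inverse r"] r r2 by (simp add: jtheta_inverse)
    have 2: "jtheta r r * qsec r 1 = qsec_const r * jtheta r 1"
      using jtheta_mult_qsec[OF r, of 1] r2 by simp
    have 3: "(jtheta p 1)\<^sup>2 = (jtheta r 1)\<^sup>2 + p * (jtheta r r)\<^sup>2"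
      using jtheta_mult[OF p, of 1 1] by (simp add: r_def power2_eq_square)
    have nz: "jtheta r r \<noteq> 0" "jtheta r 1 \<noteq> 0" "jtheta p 1 \<noteq> 0"
      using jtheta_1_nonzero jtheta_q_nonzero p r by auto
    \<comment> \<open>The doubling formula is multiplied so that both instances of the theta
      identity can be inserted. The sum of squares that appears is \<open>(jtheta p 1)^2\<close>,
      and the unknown constant is eliminated by the case \<open>v = 1\<close>.\<close>
    have "jtheta r r * (jtheta r 1)\<^sup>2 * qsec p 1 = jtheta r 1 * (jtheta r 1 * (jtheta r r * qsec r 1))
        + p * jtheta r r * jtheta r 1 * (jtheta r 1 * qsec r (inverse r))"
      unfolding qsec_1_double[OF p] r_def[symmetric] by (simp add: power2_eq_square algebra_simps)
    also have "\<dots> = (qsec_const r * jtheta r 1) * ((jtheta r 1)\<^sup>2 + p * (jtheta r r)\<^sup>2)"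
      unfolding 1 2 by (simp add: power2_eq_square algebra_simps)
    also have "\<dots> = jtheta r r * (qsec r 1 * (jtheta p 1)\<^sup>2)"
      unfolding 3[symmetric] 2[symmetric] by simp
    finally have "(jtheta r 1)\<^sup>2 * qsec p 1 = qsec r 1 * (jtheta p 1)\<^sup>2"
      using nz by simp
    thus ?thesis
      using nz unfolding \<rho>_def r_def[symmetric] by (simp add: field_simps)
  qed
  have "\<rho> (q ^ (2 ^ k)) = \<rho> q" for k
  proof (induction k)
    case (Suc k)
    thus ?case
      using step[OF doubling_norm_less_1[OF q(1)], of k] q(2) unfolding doubling_Suc by simp
  qed simp
  moreover have "(\<lambda>k. \<rho> (q ^ (2 ^ k))) \<longlonglongrightarrow> 2 * (1 / 2) / 1\<^sup>2"
    unfolding \<rho>_def using q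
    by (intro tendsto_intros tendsto_jtheta tendsto_qsec doubling_tendsto_0 doubling_norm_less_1) auto
  ultimately have "\<rho> q = 1"
    by (simp add: LIMSEQ_const_iff)
  thus ?thesis
    using jtheta_1_nonzero[OF q] by (simp add: \<rho>_def)
qed

text \<open>Evaluate the theta identity at \<open>v = 1\<close>, insert the value of
  \<open>qsec q 1\<close>, and cancel one factor \<open>jtheta q 1\<close>.\<close>

lemma qsec_const_eq:
  assumes q: "norm q < 1" "q \<noteq> 0"
  shows "2 * qsec_const q = jtheta q q * jtheta q 1"
proof -
  have "(norm q)\<^sup>2 < 1"
    using q by (simp add: power_less_one_iff)
  hence "jtheta q q * (2 * qsec q 1) = (2 * qsec_const q) * jtheta q 1"
    using jtheta_mult_qsec[OF q, of 1] by simp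
  thus ?thesis
    using jtheta_1_nonzero[OF q] unfolding qsec_1[OF q] by (simp add: power2_eq_square)
qed

lemma qsec_eq_jtheta:
  assumes q: "norm q < 1" "q \<noteq> 0" and v: "(norm q)\<^sup>2 < norm v" "(norm q)\<^sup>2 * norm v < 1" "v \<noteq> - 1"
  shows "2 * jtheta q (q * v) * qsec q v = jtheta q q * jtheta q 1 * jtheta q v"
  using jtheta_mult_qsec[OF assms] unfolding qsec_const_eq[OF q, symmetric] by simp

section \<open>The Kronecker symbol\<close>

text \<open>The nonprincipal Dirichlet character modulo 4. Its complete multiplicativity reduces the
  comparison with the Kronecker symbol to primes.\<close>

definition chi4 :: "int \<Rightarrow> int"
  where "chi4 n = (if even n then 0 else if n mod 4 = 1 then 1 else - 1)"

lemma chi4_mult: "chi4 (a * b) = chi4 a * chi4 b"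
proof (cases "odd a \<and> odd b")
  case True
  hence "a mod 4 = 1 \<or> a mod 4 = 3" "b mod 4 = 1 \<or> b mod 4 = 3"
    by presburger+
  moreover have "(a * b) mod 4 = (a mod 4) * (b mod 4) mod 4"
    by (simp add: mod_mult_eq)
  ultimately show ?thesis
    using True by (auto simp: chi4_def)
qed (auto simp: chi4_def)

lemma chi4_odd: "chi4 (int (2 * m + 1)) = (-1) ^ m"
proof (cases "even m")
  case True
  then obtain j where "m = 2 * j" ..
  thus ?thesis
    by (simp add: chi4_def)
next
  case False
  then obtain j where "m = 2 * j + 1" ..
  thus ?thesis
    by (simp add: chi4_def)
qed

text \<open>Euler's criterion with \<open>p = 2 * m + 1\<close> gives
  \<open>(-4)^m = (-1)^m * 2^(p - 1)\<close>, which is \<open>(-1)^m\<close> modulo \<open>p\<close>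
  by Fermat. Congruence implies equality, since the two values differ by at most 2 and
  \<open>p > 2\<close>.\<close>

lemma Legendre_minus_4:
  assumes "prime p" "p > 2"
  shows "Legendre (- 4) (int p) = chi4 (int p)"
proof -
  have "odd p"
    using assms prime_odd_nat by blast
  then obtain m where m: "p = 2 * m + 1" ..
  have "\<not> p dvd 2"
    using assms(2) by (simp add: nat_dvd_not_less)
  hence "[2 ^ (p - 1) = 1] (mod p)"
    by (rule fermat_theorem[OF assms(1)])
  hence "[int (2 ^ (p - 1)) = int 1] (mod (int p))"
    by (simp only: cong_int_iff)
  hence f: "[2 ^ (2 * m) = 1] (mod (int p))"
    by (simp add: m)
  have "(- 4 :: int) ^ m = (-1) ^ m * 2 ^ (2 * m)"
    by (simp add: power_mult power_mult_distrib[symmetric])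
  with euler_criterion[OF assms, of "- 4"]
  have "[Legendre (- 4) (int p) = (-1) ^ m * 2 ^ (2 * m)] (mod (int p))"
    by (simp add: m)
  also have "[(-1) ^ m * 2 ^ (2 * m) = (-1) ^ m * 1] (mod (int p))"
    by (rule cong_scalar_left[OF f])
  finally have d: "int p dvd (Legendre (- 4) (int p) - (-1) ^ m)"
    by (simp add: cong_iff_dvd_diff)
  have "\<bar>Legendre (- 4) (int p) - (-1) ^ m\<bar> \<le> 2"
    by (auto simp: Legendre_def minus_one_power_iff)
  hence "Legendre (- 4) (int p) - (-1) ^ m = 0"
    using d assms(2) dvd_imp_le_int[of "Legendre (- 4) (int p) - (-1) ^ m" "int p"] by linarith
  thus ?thesis
    using chi4_odd[of m] m by simp
qed

lemma kronecker_prime_minus_4: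
  assumes "prime p"
  shows "kronecker_prime (- 4) p = chi4 p"
proof (cases "p = 2")
  case True
  thus ?thesis
    by (simp add: kronecker_prime_def chi4_def)
next
  case False
  hence "prime (nat p)" "nat p > 2" "int (nat p) = p"
    using assms prime_ge_2_int[OF assms] by auto
  thus ?thesis
    using Legendre_minus_4[of "nat p"] False by (simp add: kronecker_prime_def)
qed

lemma kronecker_minus_4:
  assumes "n > 0"
  shows "kronecker (- 4) n = chi4 n"
proof -
  have pw: "chi4 (a ^ k) = chi4 a ^ k" for a k
    by (induction k) (auto simp: chi4_mult chi4_def[of 1])
  have pr: "chi4 (prod f A) = (\<Prod>x\<in>A. chi4 (f x))" for f :: "int \<Rightarrow> int" and A
    by (induction A rule: infinite_finite_induct) (auto simp: chi4_mult chi4_def[of 1])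
  have "kronecker (- 4) n = (\<Prod>p\<in>prime_factors n. kronecker_prime (- 4) p ^ multiplicity p n)"
    using assms by (simp add: kronecker_def)
  also have "\<dots> = (\<Prod>p\<in>prime_factors n. chi4 (p ^ multiplicity p n))"
    by (intro prod.cong refl) (simp add: pw kronecker_prime_minus_4 in_prime_factors_iff)
  also have "\<dots> = chi4 n"
    using assms by (simp add: pr[symmetric] prod_prime_factors)
  finally show ?thesis .
qed

section \<open>Trigonometric form\<close>

text \<open>From \<open>(2 * n + 1)^2 / 8 = 1 / 8 + (n^2 + n) / 2\<close> each term carries the
  common factor \<open>exp (i * pi * \<tau> / 4)\<close>. The two exponentials of the cosine are the
  terms with indices \<open>n\<close> and \<open>- n - 1\<close> of the bilateral sum.\<close>

lemma theta2_conv_jtheta: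
  assumes "Im \<tau> > 0"
  shows "theta2 z \<tau> = exp (\<i> * pi * \<tau> / 4) * exp (\<i> * z) *
    jtheta (exp (\<i> * pi * \<tau>)) (exp (\<i> * pi * \<tau>) * (exp (\<i> * z))\<^sup>2)"
proof -
  define p h W where "p = exp (\<i> * pi * \<tau>)" and "h = exp (\<i> * pi * \<tau> / 4)" and "W = exp (\<i> * z)"
  have p: "norm p < 1" "p \<noteq> 0"
    using assms by (auto simp: p_def norm_exp_eq_Re)
  have W: "W \<noteq> 0"
    by (simp add: W_def)
  let ?a = "\<lambda>n. p ^ (n\<^sup>2) * (p * W\<^sup>2) ^ n"
  let ?b = "\<lambda>n. p ^ ((Suc n)\<^sup>2) * inverse (p * W\<^sup>2) ^ Suc n"
  have sa: "summable ?a"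
    by (rule summable_norm_cancel[OF summable_norm_square_power[OF p(1)]])
  have sb: "summable ?b"
    by (subst summable_Suc_iff[where f = "\<lambda>n. p ^ (n\<^sup>2) * inverse (p * W\<^sup>2) ^ n"])
       (rule summable_norm_cancel[OF summable_norm_square_power[OF p(1)]])
  have J: "(\<lambda>n. ?a n + ?b n) sums jtheta p (p * W\<^sup>2)"
    using sums_add[OF summable_sums[OF sa] summable_sums[OF sb]]
    unfolding jtheta_eqI[OF p(1) has_sum_jtheta_aux[OF p(1)], symmetric] .
  have t: "h * W * (?a n + ?b n) = 2 * (qpow \<tau> ((2 * real n + 1)\<^sup>2 / 8) * cos ((2 * of_nat n + 1) * z))" for n
  proof -
    have "qpow \<tau> ((2 * real n + 1)\<^sup>2 / 8) = exp (\<i> * pi * \<tau> / 4 + of_nat (n\<^sup>2 + n) * (\<i> * pi * \<tau>))"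
      unfolding qpow_def by (rule arg_cong[of _ _ exp]) (simp add: power2_eq_square field_simps)
    hence Q: "qpow \<tau> ((2 * real n + 1)\<^sup>2 / 8) = h * p ^ (n\<^sup>2 + n)"
      by (simp only: exp_add exp_of_nat_mult h_def p_def)
    have e: "\<i> * ((2 * of_nat n + 1) * z) = of_nat (2 * n + 1) * (\<i> * z)"
      by (simp add: algebra_simps)
    have C: "2 * cos ((2 * of_nat n + 1) * z) = W ^ (2 * n + 1) + inverse (W ^ (2 * n + 1))"
      by (simp only: cos_exp_eq mult_minus_right minus_mult_left[symmetric] e exp_minus exp_of_nat_mult W_def)
         (simp add: mult.commute)
    have a: "W * ?a n = p ^ (n\<^sup>2 + n) * W ^ (2 * n + 1)"
      by (simp add: power_mult_distrib power_add power_mult)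
    have "p ^ ((Suc n)\<^sup>2) = p ^ (n\<^sup>2 + n) * p ^ Suc n"
      by (simp add: power2_eq_square add_ac flip: power_add power_Suc)
    moreover have "W ^ (2 * n + 1) * W = (W\<^sup>2) ^ Suc n"
      by (simp add: power2_eq_square power_mult_distrib mult_2 power_add)
    ultimately have b: "W * ?b n = p ^ (n\<^sup>2 + n) * inverse (W ^ (2 * n + 1))"
      using p(2) W by (simp add: power_mult_distrib power_inverse divide_simps del: power_Suc)
         (simp add: mult_ac)
    have "h * W * (?a n + ?b n) = h * (W * ?a n + W * ?b n)"
      by (simp only: ring_distribs mult.assoc)
    also have "\<dots> = h * p ^ (n\<^sup>2 + n) * (2 * cos ((2 * of_nat n + 1) * z))"
      unfolding a b C by (simp only: ring_distribs mult.assoc)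
    finally show ?thesis
      unfolding Q by (simp only: mult_ac)
  qed
  have "(\<lambda>n. 2 * (qpow \<tau> ((2 * real n + 1)\<^sup>2 / 8) * cos ((2 * of_nat n + 1) * z))) sums
      (h * W * jtheta p (p * W\<^sup>2))"
    using sums_mult[OF J, of "h * W"] unfolding t .
  from sums_unique[OF sums_mult_D[OF this]] have "theta2 z \<tau> = h * W * jtheta p (p * W\<^sup>2)"
    unfolding theta2_def by simp
  thus ?thesis
    by (simp only: p_def h_def W_def)
qed

text \<open>Apply the product formula to \<open>a = p * X * Y\<close> and
  \<open>b = p * X / Y\<close>, for which \<open>a * b = q * X^2\<close> and
  \<open>a / b = Y^2\<close>. Quasi-periodicity then reduces the factor with argument
  \<open>q^2 * X^2\<close> to \<open>jtheta q (X^2)\<close>.\<close>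

lemma theta2_mult_theta2:
  fixes x y \<tau> :: complex
  assumes "Im \<tau> > 0"
  defines "q \<equiv> exp (2 * \<i> * pi * \<tau>)" and "X \<equiv> exp (2 * \<i> * x)" and "Y \<equiv> exp (2 * \<i> * y)"
  shows "theta2 (x + y) \<tau> * theta2 (x - y) \<tau> = exp (\<i> * pi * \<tau> / 2) *
    (X * jtheta q (q * X\<^sup>2) * jtheta q (Y\<^sup>2) + Y * jtheta q (X\<^sup>2) * jtheta q (q * Y\<^sup>2))"
proof -
  define p where "p = exp (\<i> * pi * \<tau>)"
  have p: "norm p < 1" "p \<noteq> 0"
    using assms by (auto simp: p_def norm_exp_eq_Re)
  have q: "p\<^sup>2 = q"
    by (simp add: p_def q_def mult.assoc flip: exp_double)
  have q1: "norm q < 1" "q \<noteq> 0"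
    using p unfolding q[symmetric] by (auto simp: norm_power power_less_one_iff)
  have XY: "X \<noteq> 0" "Y \<noteq> 0"
    by (simp_all add: X_def Y_def)
  have e: "(exp (\<i> * (x + y)))\<^sup>2 = X * Y" "(exp (\<i> * (x - y)))\<^sup>2 = X / Y"
    "exp (\<i> * (x + y)) * exp (\<i> * (x - y)) = X"
    by (simp_all add: X_def Y_def power2_eq_square algebra_simps flip: exp_add exp_diff)
  have h: "exp (\<i> * pi * \<tau> / 4) * exp (\<i> * pi * \<tau> / 4) = exp (\<i> * pi * \<tau> / 2)"
    unfolding exp_add[symmetric] by (rule arg_cong[of _ _ exp]) simp
  have m: "p * (X * Y) * (p * (X / Y)) = q * X\<^sup>2" "p * (X * Y) / (p * (X / Y)) = Y\<^sup>2"
    using p XY by (simp_all add: q[symmetric] power2_eq_square field_simps)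
  have J: "q * X\<^sup>2 * jtheta q (q * (q * X\<^sup>2)) = jtheta q (X\<^sup>2)"
    using jtheta_q2_mult[OF q1, of "X\<^sup>2"] XY by (simp add: power2_eq_square mult_ac)
  have "theta2 (x + y) \<tau> * theta2 (x - y) \<tau> =
      (exp (\<i> * pi * \<tau> / 4) * exp (\<i> * pi * \<tau> / 4)) *
      ((exp (\<i> * (x + y)) * exp (\<i> * (x - y))) *
      (jtheta p (p * (X * Y)) * jtheta p (p * (X / Y))))"
    unfolding theta2_conv_jtheta[OF assms(1)] p_def[symmetric] e(1,2)
    by (simp only: mult_ac)
  also have "\<dots> = exp (\<i> * pi * \<tau> / 2) * (X * (jtheta p (p * (X * Y)) * jtheta p (p * (X / Y))))"
    unfolding h e(3) ..
  also have "jtheta p (p * (X * Y)) * jtheta p (p * (X / Y)) =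
      jtheta q (q * X\<^sup>2) * jtheta q (Y\<^sup>2) +
      p * (p * (X * Y)) * (jtheta q (q * (q * X\<^sup>2)) * jtheta q (q * Y\<^sup>2))"
    using jtheta_mult[OF p, of "p * (X * Y)" "p * (X / Y)"] p XY unfolding m q by simp
  also have "X * (jtheta q (q * X\<^sup>2) * jtheta q (Y\<^sup>2) +
      p * (p * (X * Y)) * (jtheta q (q * (q * X\<^sup>2)) * jtheta q (q * Y\<^sup>2))) =
      X * jtheta q (q * X\<^sup>2) * jtheta q (Y\<^sup>2) +
      Y * (q * X\<^sup>2 * jtheta q (q * (q * X\<^sup>2))) * jtheta q (q * Y\<^sup>2)"
    unfolding q[symmetric] by (simp add: power2_eq_square algebra_simps)
  finally show ?thesis
    unfolding J .
qed

lemma cos_odd_multiple_exp: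
  "2 * cos (2 * of_nat (2 * j + 1) * x) =
     exp (2 * \<i> * x) * ((exp (2 * \<i> * x))\<^sup>2) ^ j +
     inverse (exp (2 * \<i> * x)) * (inverse ((exp (2 * \<i> * x))\<^sup>2)) ^ j"
proof -
  have e: "\<i> * (2 * of_nat (2 * j + 1) * x) = of_nat (2 * j + 1) * (2 * \<i> * x)"
    by (simp add: algebra_simps)
  have "2 * cos (2 * of_nat (2 * j + 1) * x) =
      exp (2 * \<i> * x) ^ (2 * j + 1) + inverse (exp (2 * \<i> * x) ^ (2 * j + 1))"
    unfolding cos_exp_eq mult_minus_left e exp_minus exp_of_nat_mult by simp
  thus ?thesis
    by (simp add: power_mult power_inverse)
qed

text \<open>In the strip \<open>|q| < |X| < 1 / |q|\<close> the Lambert series for both exponentials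
  of the cosine converge. The secant is \<open>2 * X / (1 + X^2)\<close>, the elementary term of
  \<open>qsec\<close>.\<close>

lemma sec_plus_lambert_sums:
  fixes q x :: complex
  defines "X \<equiv> exp (2 * \<i> * x)"
  assumes "norm q < 1" "norm q < norm X" "norm q * norm X < 1" "cos (2 * x) \<noteq> 0"
  shows "\<exists>S. (\<lambda>j. (-1) ^ j * (q ^ (2 * j + 1) / (1 - q ^ (2 * j + 1))) * cos (2 * of_nat (2 * j + 1) * x)) sums S
    \<and> 1 / cos (2 * x) + 4 * S = 2 * qsec q (X\<^sup>2) / X \<and> X\<^sup>2 \<noteq> - 1"
proof -
  have X: "X \<noteq> 0"
    by (simp add: X_def)
  have c: "2 * cos (2 * x) = X + inverse X"
    using cos_odd_multiple_exp[of 0 x] by (simp add: X_def)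
  have cX: "X * (2 * cos (2 * x)) = 1 + X\<^sup>2"
    unfolding c using X by (simp add: power2_eq_square algebra_simps)
  hence ne: "1 + X\<^sup>2 \<noteq> 0"
    using X assms by (metis mult_eq_0_iff zero_neq_numeral)
  have n1: "(norm q)\<^sup>2 * norm (X\<^sup>2) < 1"
    using assms by (simp add: norm_power power_mult_distrib[symmetric] power_less_one_iff)
  have "norm q * norm (inverse X) < 1"
    using assms(3) X by (simp add: norm_inverse norm_divide field_simps)
  hence n2: "(norm q)\<^sup>2 * norm (inverse (X\<^sup>2)) < 1"
    by (simp add: norm_power norm_inverse power_inverse[symmetric] power_mult_distrib[symmetric] power_less_one_iff)
  let ?c = "\<lambda>j. (-1) ^ j * (q ^ (2 * j + 1) / (1 - q ^ (2 * j + 1)))"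
  have G: "(\<lambda>k. ?c k * u ^ k) sums lambert q u" if "(norm q)\<^sup>2 * norm u < 1" for u
    unfolding lambert_def by (rule summable_sums[OF summable_lambert[OF assms(2) that]])
  have "(\<lambda>j. X / 2 * (?c j * (X\<^sup>2) ^ j) + inverse X / 2 * (?c j * inverse (X\<^sup>2) ^ j)) sums
      (X / 2 * lambert q (X\<^sup>2) + inverse X / 2 * lambert q (inverse (X\<^sup>2)))" (is "_ sums ?S")
    by (intro sums_add sums_mult G n1 n2)
  also have "(\<lambda>j. X / 2 * (?c j * (X\<^sup>2) ^ j) + inverse X / 2 * (?c j * inverse (X\<^sup>2) ^ j)) =
      (\<lambda>j. ?c j * cos (2 * of_nat (2 * j + 1) * x))"
  proof
    fix j
    have "a * b = a * (2 * b) / 2" for a b :: complex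
      by simp
    hence "?c j * cos (2 * of_nat (2 * j + 1) * x) = ?c j * (2 * cos (2 * of_nat (2 * j + 1) * x)) / 2" .
    also have "\<dots> = X / 2 * (?c j * (X\<^sup>2) ^ j) + inverse X / 2 * (?c j * inverse (X\<^sup>2) ^ j)"
    proof -
      have "a * (b * c + d * e) / 2 = b / 2 * (a * c) + d / 2 * (a * e)" for a b c d e :: complex
        by (simp add: algebra_simps add_divide_distrib)
      thus ?thesis
        unfolding cos_odd_multiple_exp X_def[symmetric] .
    qed
    finally show "X / 2 * (?c j * (X\<^sup>2) ^ j) + inverse X / 2 * (?c j * inverse (X\<^sup>2) ^ j) =
      ?c j * cos (2 * of_nat (2 * j + 1) * x)" ..
  qed
  finally have "(\<lambda>j. ?c j * cos (2 * of_nat (2 * j + 1) * x)) sums ?S" .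
  moreover have "1 / cos (2 * x) + 4 * ?S = 2 * qsec q (X\<^sup>2) / X"
  proof -
    have "1 / cos (2 * x) = 2 * X / (1 + X\<^sup>2)"
      unfolding cX[symmetric] using X by simp
    moreover have "2 * qsec q (X\<^sup>2) / X =
        2 * X / (1 + X\<^sup>2) + 2 * inverse X * lambert q (inverse (X\<^sup>2)) + 2 * X * lambert q (X\<^sup>2)"
    proof -
      have "2 * (X\<^sup>2 * t + a + X\<^sup>2 * b) / X = 2 * X * t + 2 * inverse X * a + 2 * X * b" for t a b
        using X by (simp add: field_simps power2_eq_square)
      from this[of "1 / (1 + X\<^sup>2)"] show ?thesis
        by (simp add: qsec_def)
    qed
    ultimately show ?thesis
      by simp
  qed
  moreover have "X\<^sup>2 \<noteq> - 1"
    using ne by auto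
  ultimately show ?thesis
    by blast
qed

section \<open>Convergence of the combined series\<close>

text \<open>Subtracting \<open>B^2\<close> times the sequence from its shift leaves a multiple of
  \<open>(A^2)^j\<close>, which cannot tend to 0 unless \<open>A^2 = B^2\<close>. The sequence is
  then \<open>(A + B) * (A^2)^j\<close>, and the same argument gives
  \<open>A + B = 0\<close>.\<close>

lemma odd_powers_tendsto_0_imp:
  fixes A B :: complex
  assumes "norm A \<ge> 1" and lim: "(\<lambda>j. A * (A\<^sup>2) ^ j + B * (B\<^sup>2) ^ j) \<longlonglongrightarrow> 0"
  shows "B = - A"
proof -
  have pw: "D = 0" if "(\<lambda>j. D * (A\<^sup>2) ^ j) \<longlonglongrightarrow> 0" for D
  proof -
    have "norm D \<le> norm (D * (A\<^sup>2) ^ j)" for j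
      using assms(1) mult_left_mono[of 1 "(norm A ^ 2) ^ j" "norm D"]
      by (simp add: norm_mult norm_power one_le_power)
    moreover have "(\<lambda>j. norm (D * (A\<^sup>2) ^ j)) \<longlonglongrightarrow> 0"
      using tendsto_norm_zero[OF that] .
    ultimately have "norm D \<le> 0"
      using LIMSEQ_le_const by blast
    thus ?thesis by simp
  qed
  have "(\<lambda>j. (A * (A\<^sup>2) ^ Suc j + B * (B\<^sup>2) ^ Suc j) - B\<^sup>2 * (A * (A\<^sup>2) ^ j + B * (B\<^sup>2) ^ j)) \<longlonglongrightarrow> 0 - B\<^sup>2 * 0"
    by (intro tendsto_diff tendsto_mult tendsto_const lim LIMSEQ_Suc[OF lim])
  also have "(\<lambda>j. (A * (A\<^sup>2) ^ Suc j + B * (B\<^sup>2) ^ Suc j) - B\<^sup>2 * (A * (A\<^sup>2) ^ j + B * (B\<^sup>2) ^ j)) =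
      (\<lambda>j. (A * (A\<^sup>2 - B\<^sup>2)) * (A\<^sup>2) ^ j)"
    by (simp add: algebra_simps)
  finally have "A * (A\<^sup>2 - B\<^sup>2) = 0"
    by (intro pw) simp
  hence "A\<^sup>2 = B\<^sup>2"
    using assms(1) by auto
  hence "(\<lambda>j. (A + B) * (A\<^sup>2) ^ j) \<longlonglongrightarrow> 0"
    using lim by (simp add: algebra_simps)
  from pw[OF this] show ?thesis
    by (simp add: add_eq_0_iff)
qed

text \<open>The series for \<open>x\<close> and \<open>y\<close> may diverge individually while their sum converges, but only if
  they cancel term by term.\<close>

lemma summable_imp_strip_or_antipodal:
  fixes q x y :: complex
  defines "X \<equiv> exp (2 * \<i> * x)" and "Y \<equiv> exp (2 * \<i> * y)"
  assumes q: "norm q < 1" "q \<noteq> 0"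
    and u: "summable (\<lambda>j. (-1) ^ j * (q ^ (2 * j + 1) / (1 - q ^ (2 * j + 1))) *
      (cos (2 * of_nat (2 * j + 1) * x) + cos (2 * of_nat (2 * j + 1) * y)))" (is "summable ?u")
  shows "(norm q < norm X \<and> norm q * norm X < 1) \<and> (norm q < norm Y \<and> norm q * norm Y < 1) \<or>
    (Y = - X \<or> Y = - inverse X)"
proof -
  have nz: "X \<noteq> 0" "Y \<noteq> 0"
    by (simp_all add: X_def Y_def)
  \<comment> \<open>The cosines do not change when the exponential is inverted, so \<open>A\<close>
    and \<open>B\<close> can be taken as the dominant exponentials, of modulus at least 1.\<close>
  have sgn: "\<exists>Z. (Z = W \<or> Z = inverse W) \<and> norm Z \<ge> 1" if "W \<noteq> 0" for W :: complex
  proof (cases "norm W \<ge> 1")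
    case False
    hence "norm (inverse W) \<ge> 1"
      using that by (simp add: norm_inverse one_le_inverse)
    thus ?thesis by blast
  qed blast
  obtain A where A: "A = X \<or> A = inverse X" "norm A \<ge> 1"
    using sgn[OF nz(1)] by blast
  obtain B where B: "B = Y \<or> B = inverse Y" "norm B \<ge> 1"
    using sgn[OF nz(2)] by blast
  have strip: "norm q < norm W \<and> norm q * norm W < 1"
    if Z: "Z = W \<or> Z = inverse W" "norm Z \<ge> 1" "norm q * norm Z < 1" "W \<noteq> 0" for W Z :: complex
    using Z(1)
  proof
    assume "Z = W"
    thus ?thesis using Z q(1) by auto
  next
    assume Z': "Z = inverse W"
    have n: "norm Z = inverse (norm W)" "norm W > 0"
      using Z by (auto simp: Z' norm_inverse)
    hence "norm W \<le> 1" "norm q < norm W"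
      using Z(2,3) by (auto simp: field_simps)
    thus ?thesis
      using Z' q(1) Z(4) mult_left_mono[of "norm W" 1 "norm q"] by auto
  qed
  \<comment> \<open>The terms of the series tend to 0. Multiplication by the bounded factor
    \<open>2 * (-1)^j * (1 - q^(2 * j + 1))\<close> leaves the odd powers of \<open>q * A\<close>,
    \<open>q * B\<close>, \<open>q / A\<close> and \<open>q / B\<close>; the last two decay and are
    subtracted.\<close>
  have lim: "(\<lambda>j. (q * A) * ((q * A)\<^sup>2) ^ j + (q * B) * ((q * B)\<^sup>2) ^ j) \<longlonglongrightarrow> 0"
  proof -
    have u: "?u \<longlonglongrightarrow> 0"
      by (rule summable_LIMSEQ_zero[OF u])
    have small: "(\<lambda>j. a * b ^ j) \<longlonglongrightarrow> 0" if "norm b < 1" for a b :: complex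
      using tendsto_mult[OF tendsto_const[of a] LIMSEQ_power_zero[OF that]] by simp
    have q2: "norm (q\<^sup>2) < 1"
      using q by (simp add: norm_power power_less_one_iff)
    have inv: "norm ((q * inverse Z)\<^sup>2) < 1" if "norm Z \<ge> 1" for Z :: complex
    proof -
      have "norm q * norm (inverse Z) \<le> norm q * 1"
        using that by (intro mult_left_mono) (auto simp: norm_inverse inverse_le_1_iff)
      hence "norm (q * inverse Z) < 1"
        using q(1) by (simp add: norm_mult)
      thus ?thesis
        by (simp add: norm_power power_less_one_iff del: norm_mult)
    qed
    have "(\<lambda>j. (2 - 2 * q * (q\<^sup>2) ^ j) * ((- 1) ^ j * ?u j) -
        q * inverse A * ((q * inverse A)\<^sup>2) ^ j - q * inverse B * ((q * inverse B)\<^sup>2) ^ j)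
        \<longlonglongrightarrow> (2 - 0) * 0 - 0 - 0"
    proof (intro tendsto_diff tendsto_mult[of _ "2 - 0"] small inv A B q2 tendsto_const)
      show "(\<lambda>j. (- 1) ^ j * ?u j) \<longlonglongrightarrow> 0"
      proof (rule Lim_null_comparison[OF always_eventually tendsto_norm_zero[OF u]], rule allI)
        have "norm ((- 1) ^ j * z) \<le> norm z" for j and z :: complex
          by (simp add: norm_mult norm_power)
        thus "norm ((- 1) ^ j * ?u j) \<le> norm (?u j)" for j .
      qed
    qed
    moreover have "(2 - 2 * q * (q\<^sup>2) ^ j) * ((- 1) ^ j * ?u j) -
        q * inverse A * ((q * inverse A)\<^sup>2) ^ j - q * inverse B * ((q * inverse B)\<^sup>2) ^ j =
        (q * A) * ((q * A)\<^sup>2) ^ j + (q * B) * ((q * B)\<^sup>2) ^ j" for j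
    proof -
      have ne: "1 - q ^ (2 * j + 1) \<noteq> 0"
        using power_Suc_neq_1[OF q(1), of "2 * j"] by simp
      have qj: "q * (q\<^sup>2) ^ j = q ^ (2 * j + 1)"
        by (simp add: power_mult)
      have ee: "((-1) ^ j * (-1) ^ j :: complex) = 1"
        by (simp flip: power_mult_distrib)
      have cA: "2 * cos (2 * of_nat (2 * j + 1) * x) = A * (A\<^sup>2) ^ j + inverse A * (inverse (A\<^sup>2)) ^ j"
        using A(1) cos_odd_multiple_exp[of j x]
        by (elim disjE) (simp_all only: X_def[symmetric] inverse_inverse_eq power_inverse add.commute)
      have cB: "2 * cos (2 * of_nat (2 * j + 1) * y) = B * (B\<^sup>2) ^ j + inverse B * (inverse (B\<^sup>2)) ^ j"
        using B(1) cos_odd_multiple_exp[of j y]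
        by (elim disjE) (simp_all only: Y_def[symmetric] inverse_inverse_eq power_inverse add.commute)
      have "(2 - 2 * q * (q\<^sup>2) ^ j) * ((- 1) ^ j * ?u j) =
          ((-1) ^ j * (-1) ^ j) * ((1 - q ^ (2 * j + 1)) * (q ^ (2 * j + 1) / (1 - q ^ (2 * j + 1)))) *
          (2 * cos (2 * of_nat (2 * j + 1) * x) + 2 * cos (2 * of_nat (2 * j + 1) * y))"
      proof -
        have "(2 - 2 * Q) * (s * (s * r * (a + b))) = (s * s) * ((1 - Q) * r) * (2 * a + 2 * b)"
          for Q s r a b :: complex
          by (simp add: algebra_simps)
        thus ?thesis
          unfolding mult.assoc[of 2 q] qj .
      qed
      also have "\<dots> = q * (q\<^sup>2) ^ j * ((A * (A\<^sup>2) ^ j + inverse A * (inverse (A\<^sup>2)) ^ j) +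
           (B * (B\<^sup>2) ^ j + inverse B * (inverse (B\<^sup>2)) ^ j))"
        unfolding ee cA cB qj using ne by simp
      finally show ?thesis
        by (simp add: power_mult_distrib power_inverse algebra_simps)
    qed
    ultimately show ?thesis
      by simp
  qed
  show ?thesis
  proof (cases "norm q * norm A < 1 \<and> norm q * norm B < 1")
    case True
    thus ?thesis
      using strip[OF A _ nz(1)] strip[OF B _ nz(2)] by blast
  next
    case False
    \<comment> \<open>At least one of \<open>q * A\<close>, \<open>q * B\<close> has modulus at
      least 1, so the limit lemma applies with that one as the first argument; both orders yield the
      same equation.\<close>
    hence "q * B = - (q * A)"
      using odd_powers_tendsto_0_imp[OF _ lim]
        odd_powers_tendsto_0_imp[of "q * B" "q * A"] lim
      by (fastforce simp: norm_mult add.commute not_less)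
    hence "B = - A"
      using q(2) by (metis mult_left_cancel mult_minus_right)
    hence "Y = - X \<or> Y = - inverse X"
      using A(1) B(1) by (metis inverse_inverse_eq inverse_minus_eq minus_minus)
    thus ?thesis
      by blast
  qed
qed

theorem theorem3p18:
  fixes \<tau> x y :: complex
  assumes "Im \<tau> > 0"
    and "cos (2 * x) \<noteq> 0" and "cos (2 * y) \<noteq> 0"
    and "summable (\<lambda>k. let n = Suc k in
           of_int (kronecker (- 4) (int n)) * (qpow \<tau> (real n) / (1 - qpow \<tau> (real n))) *
           (cos (2 * of_nat n * x) + cos (2 * of_nat n * y)))"
    and "theta2 (2 * x) (2 * \<tau>) \<noteq> 0" and "theta2 (2 * y) (2 * \<tau>) \<noteq> 0"
  shows "1 / cos (2 * x) + 1 / cos (2 * y) +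
      4 * (\<Sum>k. let n = Suc k in
           of_int (kronecker (- 4) (int n)) * (qpow \<tau> (real n) / (1 - qpow \<tau> (real n))) *
           (cos (2 * of_nat n * x) + cos (2 * of_nat n * y)))
    = (vartheta2 \<tau>)\<^sup>2 *
        ((theta2 (x + y) \<tau> * theta2 (x - y) \<tau>) /
         (2 * theta2 (2 * x) (2 * \<tau>) * theta2 (2 * y) (2 * \<tau>)))"
proof -
  define q h X Y where "q = exp (2 * \<i> * pi * \<tau>)" and "h = exp (\<i> * pi * \<tau> / 2)"
    and "X = exp (2 * \<i> * x)" and "Y = exp (2 * \<i> * y)"
  have q: "norm q < 1" "q \<noteq> 0"
    using assms(1) by (auto simp: q_def norm_exp_eq_Re)
  have nz: "h \<noteq> 0" "X \<noteq> 0" "Y \<noteq> 0"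
    by (simp_all add: h_def X_def Y_def)
  let ?c = "\<lambda>j. (-1) ^ j * (q ^ (2 * j + 1) / (1 - q ^ (2 * j + 1)))"
  let ?t = "\<lambda>k. let n = Suc k in
           of_int (kronecker (- 4) (int n)) * (qpow \<tau> (real n) / (1 - qpow \<tau> (real n))) *
           (cos (2 * of_nat n * x) + cos (2 * of_nat n * y))"
  let ?u = "\<lambda>j. ?c j * (cos (2 * of_nat (2 * j + 1) * x) + cos (2 * of_nat (2 * j + 1) * y))"
  have qp: "qpow \<tau> (real n) = q ^ n" for n
    unfolding qpow_def q_def exp_of_nat_mult[symmetric] by (rule arg_cong[of _ _ exp]) simp
  have tu: "?t (2 * j) = ?u j" for j
    using chi4_odd[of j] by (simp add: Let_def kronecker_minus_4 qp del: of_nat_Suc power_Suc)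
  \<comment> \<open>As \<open>n = Suc k\<close>, an odd \<open>k\<close> belongs to an even
    \<open>n\<close>, where the symbol vanishes. The series is therefore supported on
    \<open>k = 2 * j\<close>, that is \<open>n = 2 * j + 1\<close>.\<close>
  have t0: "?t k = 0" if "k \<notin> range (\<lambda>j. 2 * j)" for k
  proof -
    have "odd k"
      using that by (metis evenE rangeI)
    thus ?thesis
      by (simp add: kronecker_minus_4 chi4_def del: of_nat_Suc)
  qed
  have tsums: "?u sums S \<longleftrightarrow> ?t sums S" for S
    using sums_mono_reindex[of "\<lambda>j. 2 * j" ?t S] t0 by (simp only: tu strict_mono_def) simp
  have th: "theta2 (x + y) \<tau> * theta2 (x - y) \<tau> =
      h * (X * jtheta q (q * X\<^sup>2) * jtheta q (Y\<^sup>2) + Y * jtheta q (X\<^sup>2) * jtheta q (q * Y\<^sup>2))"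
    unfolding q_def h_def X_def Y_def by (rule theta2_mult_theta2[OF assms(1)])
  have th2: "theta2 (2 * z) (2 * \<tau>) = h * exp (2 * \<i> * z) * jtheta q (q * (exp (2 * \<i> * z))\<^sup>2)" for z
  proof -
    have "\<i> * pi * (2 * \<tau>) / 4 = \<i> * pi * \<tau> / 2" "\<i> * (2 * z) = 2 * \<i> * z"
      "\<i> * pi * (2 * \<tau>) = 2 * \<i> * pi * \<tau>"
      by simp_all
    thus ?thesis
      using theta2_conv_jtheta[of "2 * \<tau>" "2 * z"] assms(1) by (simp only: q_def h_def) simp
  qed
  have "summable ?u"
    using assms(4) tsums unfolding summable_def by blast
  from summable_imp_strip_or_antipodal[OF q this]
  consider "norm q < norm X" "norm q * norm X < 1" "norm q < norm Y" "norm q * norm Y < 1"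
    | "Y = - X \<or> Y = - inverse X"
    unfolding X_def Y_def by blast
  thus ?thesis
  proof cases
    case 1
    have X: "norm q < norm (exp (2 * \<i> * x))" "norm q * norm (exp (2 * \<i> * x)) < 1"
      and Y: "norm q < norm (exp (2 * \<i> * y))" "norm q * norm (exp (2 * \<i> * y)) < 1"
      using 1 by (simp_all only: X_def Y_def)
    obtain S where S: "(\<lambda>j. ?c j * cos (2 * of_nat (2 * j + 1) * x)) sums S"
      "1 / cos (2 * x) + 4 * S = 2 * qsec q (X\<^sup>2) / X" "X\<^sup>2 \<noteq> - 1"
      using sec_plus_lambert_sums[OF q(1) X assms(2)] unfolding X_def by blast
    obtain T where T: "(\<lambda>j. ?c j * cos (2 * of_nat (2 * j + 1) * y)) sums T"
      "1 / cos (2 * y) + 4 * T = 2 * qsec q (Y\<^sup>2) / Y" "Y\<^sup>2 \<noteq> - 1"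
      using sec_plus_lambert_sums[OF q(1) Y assms(3)] unfolding Y_def by blast
    have "?u sums (S + T)"
      using sums_add[OF S(1) T(1)] by (simp only: ring_distribs)
    hence "suminf ?t = S + T"
      unfolding tsums by (rule sums_unique[symmetric])
    hence lhs: "1 / cos (2 * x) + 1 / cos (2 * y) + 4 * suminf ?t = 2 * qsec q (X\<^sup>2) / X + 2 * qsec q (Y\<^sup>2) / Y"
      using S(2) T(2) by (simp add: algebra_simps)
    define a b where "a = jtheta q (q * X\<^sup>2)" and "b = jtheta q (q * Y\<^sup>2)"
    have ab: "a \<noteq> 0" "b \<noteq> 0"
      using assms(5,6) by (auto simp: th2 a_def b_def X_def Y_def)
    have sq: "(norm q)\<^sup>2 < norm (W\<^sup>2)" "(norm q)\<^sup>2 * norm (W\<^sup>2) < 1"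
      if "norm q < norm W" "norm q * norm W < 1" for W :: complex
      using that by (simp_all add: norm_power power_strict_mono power_less_one_iff flip: power_mult_distrib)
    define K where "K = jtheta q q * jtheta q 1"
    have fX: "2 * qsec q (X\<^sup>2) = K * jtheta q (X\<^sup>2) / a"
      using qsec_eq_jtheta[OF q sq[OF 1(1,2)] S(3)] ab unfolding a_def K_def by (simp add: field_simps)
    have fY: "2 * qsec q (Y\<^sup>2) = K * jtheta q (Y\<^sup>2) / b"
      using qsec_eq_jtheta[OF q sq[OF 1(3,4)] T(3)] ab unfolding b_def K_def by (simp add: field_simps)
    \<comment> \<open>This is the addition formula at \<open>x = y = 0\<close>, where
      \<open>X = Y = 1\<close> and its two summands coincide.\<close>
    have v2: "(vartheta2 \<tau>)\<^sup>2 = 2 * h * K"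
      using theta2_mult_theta2[OF assms(1), of 0 0]
      by (simp add: vartheta2_def K_def power2_eq_square flip: q_def h_def)
    have "2 * h * K * (h * (X * a * jtheta q (Y\<^sup>2) + Y * jtheta q (X\<^sup>2) * b) / (2 * (h * X * a) * (h * Y * b))) =
        K * jtheta q (X\<^sup>2) / a / X + K * jtheta q (Y\<^sup>2) / b / Y"
      using nz ab by (simp add: field_simps)
    thus ?thesis
      unfolding lhs th th2 v2 X_def[symmetric] Y_def[symmetric] a_def[symmetric] b_def[symmetric] fX fY
      by simp
  next
    case 2
    have cz: "cos (2 * of_nat (2 * j + 1) * x) + cos (2 * of_nat (2 * j + 1) * y) = 0" for j
    proof -
      have "2 * cos (2 * of_nat (2 * j + 1) * y) = - (2 * cos (2 * of_nat (2 * j + 1) * x))"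
        unfolding cos_odd_multiple_exp X_def[symmetric] Y_def[symmetric] using 2 nz
        by (elim disjE) (simp_all add: power_inverse)
      thus ?thesis
        by simp
    qed
    have "?u sums 0"
      unfolding cz by simp
    hence t: "suminf ?t = 0"
      unfolding tsums by (rule sums_unique[symmetric])
    have "cos (2 * y) = - cos (2 * x)"
      using cz[of 0] by (simp add: add_eq_0_iff)
    \<comment> \<open>The secants and the series have cancelled, so the numerator has to vanish. For
      \<open>Y = - X\<close> its two summands are opposite at once; for \<open>Y = - 1 / X\<close>
      they become opposite after inversion and reflection of the theta values.\<close>
    moreover have "theta2 (x + y) \<tau> * theta2 (x - y) \<tau> = 0"
      using 2
    proof
      assume "Y = - X"
      thus ?thesis
        unfolding th by simp
    next
      assume Y: "Y = - inverse X"
      have Y2: "Y\<^sup>2 = inverse (X\<^sup>2)"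
        by (simp add: Y power_inverse)
      have "jtheta q (q * inverse (X\<^sup>2)) = X\<^sup>2 * jtheta q (q * X\<^sup>2)"
        using nz by (intro jtheta_q_inverse q) simp
      thus ?thesis
        unfolding th Y2 jtheta_inverse[OF q(1)] using nz by (simp add: Y power2_eq_square)
    qed
    ultimately show ?thesis
      unfolding t by simp
  qed
qed

end
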